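(* Let $\alpha>n$ and let $f\in L^2(\mathbb R^n)$ be log-concave. Then \[\frac{\Gamma(n+1)^{\alpha/n}}{\Gamma(\alpha)}|\mathrm{H}_\alpha f|^{\alpha/n}\le\|f\|_2^{2-\frac{2\alpha}n}\|f\|_1^{\frac{2\alpha}n}\le\Vert f\Vert_{\frac{2n}{n+\alpha}}^2.\] There is equality in the first inequality if $f(x)=a\,e^{-\Vert x-x_0\Vert_\Delta}$ for $x\in\mathbb R^n$, with $a\ge0$, $x_0\in\mathbb R^n$ and $\Delta$ an $n$-dimensional simplex having a vertex at the origin.
   Context: $f$ log-concave: $\log f$ concave with values in $[-\infty,\infty)$. $\Vert x\Vert_K=\inf\{\lambda>0:x\in\lambda K\}$ is the gauge of $K$. $\Vert f\Vert_p=(\int|f|^p)^{1/p}$ also for $0<p<1$. $\mathrm{H}_\alpha f$ is the star-shaped set with radial function $\rho_{\mathrm{H}_\alpha f}(\xi)=\big(\int_0^\infty t^{\alpha-1}\int_{\mathbb R^n}f(x)f(x+t\xi)\,dx\,dt\big)^{1/\alpha}$ for $\xi\in\mathbb S^{n-1}$, and $|\mathrm{H}_\alpha f|=\frac1n\int_{\mathbb S^{n-1}}\rho_{\mathrm{H}_\alpha f}(\xi)^n\,d\xi$. *)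

theory Defs
  imports "HOL-Analysis.Analysis"
begin

text \<open>Log-concavity of a nonnegative function: log f concave with values in [-infinity, infinity).
  Written out without logarithms (f x = 0 corresponds to log f x = -infinity).\<close>
definition log_concave :: "('a::real_vector \<Rightarrow> real) \<Rightarrow> bool" where
  "log_concave f \<longleftrightarrow> (\<forall>x. 0 \<le> f x) \<and>
     (\<forall>x y t. 0 \<le> t \<and> t \<le> 1 \<longrightarrow>
        f x powr (1 - t) * f y powr t \<le> f ((1 - t) *\<^sub>R x + t *\<^sub>R y))"

definition Lp_norm :: "real \<Rightarrow> ('a::euclidean_space \<Rightarrow> real) \<Rightarrow> real" where
  "Lp_norm p f = enn2real (\<integral>\<^sup>+ x. ennreal (\<bar>f x\<bar> powr p) \<partial>lebesgue) powr (1 / p)"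

text \<open>The alpha-th power of the radial function of H_alpha f in direction xi.\<close>
definition H_rad_pow :: "real \<Rightarrow> ('a::euclidean_space \<Rightarrow> real) \<Rightarrow> 'a \<Rightarrow> ennreal" where
  "H_rad_pow \<alpha> f \<xi> =
     (\<integral>\<^sup>+ t \<in> {0<..}. ennreal (t powr (\<alpha> - 1)) *
        (\<integral>\<^sup>+ x. ennreal (f x * f (x + t *\<^sub>R \<xi>)) \<partial>lebesgue) \<partial>lborel)"

definition H_set :: "real \<Rightarrow> ('a::euclidean_space \<Rightarrow> real) \<Rightarrow> 'a set" where
  "H_set \<alpha> f = {x. x = 0 \<or> ennreal (norm x powr \<alpha>) \<le> H_rad_pow \<alpha> f (sgn x)}"

text \<open>Gauge of K (extended-real valued, infinity if no dilate of K contains x).\<close>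
definition gauge_fn :: "'a::real_vector set \<Rightarrow> 'a \<Rightarrow> ereal" where
  "gauge_fn K x = Inf {ereal l | l. l > 0 \<and> x \<in> (\<lambda>y. l *\<^sub>R y) ` K}"

definition exp_neg_ereal :: "ereal \<Rightarrow> real" where
  "exp_neg_ereal t = (if t = \<infinity> then 0 else exp (- real_of_ereal t))"

end

theory Submission
  imports Defs
begin

text \<open>
  Let g(y) be the integral of f(x) f(x + y) over x. By the Prekopa--Leindler inequality g is
  log-concave, with g(0) = |f|_2^2 and total integral |f|_1^2. Along a ray, a log-concave function
  crosses an exponential with the same value at 0 and the same n-th moment only once, from above to
  below, so its higher moments are at most those of the exponential. Applied in every direction, this
  bounds the radial function of H_alpha f by the n-th moment of g along the ray, and integration in
  polar coordinates gives the first inequality. For the simplex exponential, g is exactly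
  exponential along each ray. The second inequality interpolates the 1-norm between the p-norm and
  the 2-norm; the p-norms are finite because a log-concave function in L^2 lies in L^p for
  all smaller p.
\<close>


text \<open>The comparison bounds the moment of order \<open>\<alpha>\<close> on a ray by a multiple
  of the power \<open>\<alpha> / n\<close> of the moment of order n, and the volume uses its power
  \<open>n / \<alpha>\<close>. The two exponents cancel, so the volume density is bounded by a
  constant times the moment of order n itself; integrating over directions therefore costs no
  further inequality, and equality on every ray is equality of volumes. Only the value at the origin
  and one other point of a ray enter the comparison, so log-concavity of g is stated for such pairs.
  Two obstacles shape the rest. Before finiteness is known, the integrals may be infinite, so the
  Prekopa--Leindler inequality is proved for extended values. And f is log-concave but perhaps not
  Borel, whereas Fubini is applied to Borel functions; f is first replaced by a Borel function equal
  to it almost everywhere, which changes \<open>H_rad_pow\<close> in no direction, because shifts of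
  null sets are null. Prekopa--Leindler itself comes from sums of sets on the line: normalising by
  the suprema makes the arithmetic-geometric mean inequality turn additive length bounds into a
  multiplicative one.\<close>

text \<open>The relation a^(1-l) * b^l <= c for extended nonnegative reals, phrased through smaller
  positive reals so that it needs no powers of infinity and passes to suprema in a and b.\<close>

definition geo_le :: "real \<Rightarrow> ennreal \<Rightarrow> ennreal \<Rightarrow> ennreal \<Rightarrow> bool" where
  "geo_le l a b c \<longleftrightarrow> (\<forall>p q. 0 < p \<longrightarrow> 0 < q \<longrightarrow> ennreal p < a \<longrightarrow> ennreal q < b \<longrightarrow>
     ennreal (p powr (1 - l) * q powr l) \<le> c)"

lemma geo_leD:
  "geo_le l a b c \<Longrightarrow> 0 < p \<Longrightarrow> 0 < q \<Longrightarrow> ennreal p < a \<Longrightarrow> ennreal q < b \<Longrightarrow>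
     ennreal (p powr (1 - l) * q powr l) \<le> c"
  by (auto simp: geo_le_def)

lemma geo_le_mono:
  "geo_le l a b c \<Longrightarrow> a' \<le> a \<Longrightarrow> b' \<le> b \<Longrightarrow> geo_le l a' b' c"
  unfolding geo_le_def by (meson order_less_le_trans)

lemma powr_geo_mean_le_arith_mean:
  fixes p q l :: real
  assumes "0 < p" "0 < q" "0 \<le> l" "l \<le> 1"
  shows "p powr (1 - l) * q powr l \<le> (1 - l) * p + l * q"
proof -
  have "exp ((1 - l) * ln p + l * ln q) \<le> (1 - l) * exp (ln p) + l * exp (ln q)"
    using convex_onD[OF exp_convex, of l "ln p" "ln q"] assms by simp
  moreover have "p powr (1 - l) * q powr l = exp ((1 - l) * ln p + l * ln q)"
    using assms by (simp add: powr_def exp_add)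
  ultimately show ?thesis using assms by simp
qed

lemma geo_le_ennrealI:
  fixes a b c :: real
  assumes "0 \<le> a" "0 \<le> b" "0 \<le> l" "l \<le> 1" and le: "a powr (1 - l) * b powr l \<le> c"
  shows "geo_le l (ennreal a) (ennreal b) (ennreal c)"
  unfolding geo_le_def
proof (intro allI impI)
  fix p q :: real assume "0 < p" "0 < q" "ennreal p < ennreal a" "ennreal q < ennreal b"
  then have "p powr (1 - l) * q powr l \<le> a powr (1 - l) * b powr l"
    using assms by (intro mult_mono powr_mono2) (auto simp: ennreal_less_iff)
  with le show "ennreal (p powr (1 - l) * q powr l) \<le> ennreal c"
    by (intro ennreal_leI) simp
qed

text \<open>\<open>geo_le\<close> tests only values strictly below its arguments. Testing
  \<open>s * a\<close> and \<open>s * b\<close> and letting \<open>s\<close> increase to 1 recovers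
  the closed inequality by continuity.\<close>

lemma geo_le_ennrealD:
  fixes a b c :: real
  assumes G: "geo_le l (ennreal a) (ennreal b) (ennreal c)"
    and "0 \<le> a" "0 \<le> b" "0 \<le> c"
  shows "a powr (1 - l) * b powr l \<le> c"
proof (cases "a = 0 \<or> b = 0")
  case False
  with assms have "0 < a" "0 < b" by auto
  have ev: "\<forall>\<^sub>F s in at_left (1::real). (s * a) powr (1 - l) * (s * b) powr l \<le> c"
  proof -
    have "\<forall>\<^sub>F s in at_left (1::real). s \<in> {0<..<1}"
      by (rule eventually_at_left_real) simp
    then show ?thesis
    proof eventually_elim
      case (elim s)
      then have "ennreal ((s * a) powr (1 - l) * (s * b) powr l) \<le> ennreal c"
        using \<open>0 < a\<close> \<open>0 < b\<close> by (intro geo_leD[OF G]) (auto simp: ennreal_less_iff)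
      then show ?case using assms by (simp add: ennreal_le_iff)
    qed
  qed
  have "((\<lambda>s. (s * a) powr (1 - l) * (s * b) powr l) \<longlongrightarrow> (1 * a) powr (1 - l) * (1 * b) powr l) (at_left 1)"
    using \<open>0 < a\<close> \<open>0 < b\<close> by (intro tendsto_intros) auto
  from tendsto_upperbound[OF this ev] show ?thesis by simp
qed (use assms in auto)

section \<open>The Prekopa--Leindler inequality, from the line to Euclidean space\<close>

text \<open>If \<open>a\<close> were the maximum of \<open>A\<close> and \<open>b\<close> the
  minimum of \<open>B\<close>, the translates \<open>b + A\<close> and \<open>a + B\<close> would
  lie in \<open>C\<close> and share only the point \<open>a + b\<close>. With extremal points
  replaced by points within \<open>e/2\<close> of the supremum and infimum, trimming
  \<open>A\<close> above \<open>a\<close> and \<open>B\<close> up to \<open>b\<close> makes the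
  translates disjoint and loses at most \<open>e\<close>.\<close>

lemma Brunn_Minkowski_real:
  fixes A B C :: "real set"
  assumes [measurable]: "A \<in> sets borel" "B \<in> sets borel" "C \<in> sets borel"
    and "A \<noteq> {}" "B \<noteq> {}" "bdd_above A" "bdd_below B"
    and sum: "\<And>x y. x \<in> A \<Longrightarrow> y \<in> B \<Longrightarrow> x + y \<in> C"
  shows "emeasure lborel A + emeasure lborel B \<le> emeasure lborel C"
proof (rule ennreal_le_epsilon)
  fix e :: real assume "0 < e"
  obtain a where a: "a \<in> A" "Sup A - e/2 < a"
    using less_cSupD[of A "Sup A - e/2"] assms \<open>0 < e\<close> by auto
  obtain b where b: "b \<in> B" "b < Inf B + e/2"
    using cInf_lessD[of B "Inf B + e/2"] assms \<open>0 < e\<close> by auto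
  let ?A = "A \<inter> {..a}" and ?B = "B \<inter> {b<..}"
  have "emeasure lborel A \<le> emeasure lborel (?A \<union> {a..a+e/2})"
    using a cSup_upper[OF _ \<open>bdd_above A\<close>] by (intro emeasure_mono) fastforce+
  also have "\<dots> \<le> emeasure lborel ?A + emeasure lborel {a..a+e/2}"
    by (intro emeasure_subadditive) auto
  finally have 1: "emeasure lborel A \<le> emeasure lborel ?A + ennreal (e/2)"
    using \<open>0 < e\<close> by simp
  have "emeasure lborel B \<le> emeasure lborel (?B \<union> {b-e/2..b})"
    using b cInf_lower[OF _ \<open>bdd_below B\<close>] by (intro emeasure_mono) fastforce+
  also have "\<dots> \<le> emeasure lborel ?B + emeasure lborel {b-e/2..b}"
    by (intro emeasure_subadditive) auto
  finally have 2: "emeasure lborel B \<le> emeasure lborel ?B + ennreal (e/2)"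
    using \<open>0 < e\<close> by simp
  have shift: "emeasure lborel ((+) c ` X) = emeasure lborel X" if "X \<in> sets borel" for c :: real and X
  proof -
    have "(+) c ` X = (+) (- c) -` X" by (force simp: image_iff)
    moreover have "emeasure lborel X = emeasure (distr lborel borel ((+) (- c))) X"
      by (simp add: lborel_distr_plus)
    ultimately show ?thesis using that by (subst (asm) emeasure_distr) auto
  qed
  have meas: "(+) c ` X \<in> sets borel" if [measurable]: "X \<in> sets borel" for c :: real and X
  proof -
    have "(+) c ` X = (\<lambda>x. - c + x) -` X \<inter> space borel" by (force simp: image_iff)
    also have "\<dots> \<in> sets borel" by measurable
    finally show ?thesis .
  qed
  have "emeasure lborel ?A + emeasure lborel ?B
      = emeasure lborel ((+) b ` ?A) + emeasure lborel ((+) a ` ?B)"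
    by (simp add: shift)
  also have "\<dots> = emeasure lborel ((+) b ` ?A \<union> (+) a ` ?B)"
    by (rule plus_emeasure) (use meas in \<open>auto\<close>)
  also have "\<dots> \<le> emeasure lborel C"
    using a b sum[of _ b] sum[of a]
    by (intro emeasure_mono) (auto simp: add.commute[of b])
  finally have 3: "emeasure lborel ?A + emeasure lborel ?B \<le> emeasure lborel C" .
  have "emeasure lborel A + emeasure lborel B
      \<le> (emeasure lborel ?A + ennreal (e/2)) + (emeasure lborel ?B + ennreal (e/2))"
    using 1 2 by (rule add_mono)
  also have "\<dots> = (emeasure lborel ?A + emeasure lborel ?B) + (ennreal (e/2) + ennreal (e/2))"
    by (simp add: algebra_simps)
  also have "\<dots> = (emeasure lborel ?A + emeasure lborel ?B) + ennreal e"
    using \<open>0 < e\<close> by (simp flip: ennreal_plus)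
  also have "\<dots> \<le> emeasure lborel C + ennreal e" using 3 by (rule add_right_mono)
  finally show "emeasure lborel A + emeasure lborel B \<le> emeasure lborel C + ennreal e" .
qed

lemma emeasure_lborel_real_scale:
  fixes c :: real
  assumes "0 < c" and [measurable]: "X \<in> sets borel"
  shows "emeasure lborel ((\<lambda>x. x / c) -` X) = ennreal c * emeasure lborel X"
proof -
  have "emeasure lborel ((\<lambda>x. x / c) -` X) = (\<integral>\<^sup>+x. indicator ((\<lambda>x. x / c) -` X) x \<partial>lborel)"
    using assms by (subst nn_integral_indicator) (auto intro!: measurable_sets_borel[of _ borel, OF _ assms(2)])
  also have "\<dots> = c * (\<integral>\<^sup>+x. indicator ((\<lambda>x. x / c) -` X) (0 + c * x) \<partial>lborel)"
    using assms by (subst nn_integral_real_affine[where c=c and t=0])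
      (auto simp: intro!: borel_measurable_indicator measurable_sets_borel[of _ borel, OF _ assms(2)])
  also have "(\<lambda>x. indicator ((\<lambda>x. x / c) -` X) (0 + c * x)) = (indicator X :: real \<Rightarrow> ennreal)"
    using assms by (auto simp: indicator_def)
  finally show ?thesis by simp
qed

text \<open>Both the strict and the non-strict superlevel sets are needed: the hypothesis of the
  Prekopa--Leindler inequality carries strict superlevel sets to non-strict ones.\<close>

lemma nn_integral_superlevel:
  fixes f :: "real \<Rightarrow> ennreal" and a :: real
  assumes [measurable]: "f \<in> borel_measurable borel" and "0 < a"
  shows "(\<integral>\<^sup>+x. f x \<partial>lborel) =
      ennreal a * (\<integral>\<^sup>+s. emeasure lborel {x. ennreal (a * s) < f x} * indicator {0<..} s \<partial>lborel)"
    and "(\<integral>\<^sup>+x. f x \<partial>lborel) =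
      ennreal a * (\<integral>\<^sup>+s. emeasure lborel {x. ennreal (a * s) \<le> f x} * indicator {0<..} s \<partial>lborel)"
proof -
  \<comment> \<open>For a fixed value \<open>u\<close> the admissible levels \<open>s\<close> form
    an interval of length \<open>u / a\<close>, open or closed at its end; for infinite
    \<open>u\<close> it is the whole half-line.\<close>
  have len: "ennreal a * emeasure lborel {s. 0 < s \<and> ennreal (a * s) < u} = u"
       "ennreal a * emeasure lborel {s. 0 < s \<and> ennreal (a * s) \<le> u} = u" for u
  proof -
    have "ennreal a * emeasure lborel {s. 0 < s \<and> ennreal (a * s) < u} = u \<and>
          ennreal a * emeasure lborel {s. 0 < s \<and> ennreal (a * s) \<le> u} = u"
    proof (cases u)
      case (real r)
      have "{s. 0 < s \<and> ennreal (a * s) < u} = {0<..<r/a}" "{s. 0 < s \<and> ennreal (a * s) \<le> u} = {0<..r/a}"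
        using real \<open>0 < a\<close> by (auto simp: ennreal_less_iff field_simps)
      then show ?thesis using real \<open>0 < a\<close> by (simp flip: ennreal_mult)
    next
      case top
      have "{s. 0 < s \<and> ennreal (a * s) < u} = {0<..}" "{s. 0 < s \<and> ennreal (a * s) \<le> u} = {0<..}"
        using top by (auto simp: less_top)
      moreover have "emeasure lborel {0::real<..} = \<infinity>"
      proof -
        have "ennreal (real k) \<le> emeasure lborel {0::real<..}" for k :: nat
        proof -
          have "emeasure lborel {0<..real k} \<le> emeasure lborel {0::real<..}"
            by (intro emeasure_mono) auto
          then show ?thesis by simp
        qed
        note ge = this
        show ?thesis
        proof (cases "emeasure lborel {0::real<..}")
          case (real r)
          obtain k :: nat where "r < real k" using reals_Archimedean2 by blast
          with ge[of k] real show ?thesis by simp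
        qed simp
      qed
      ultimately show ?thesis using top \<open>0 < a\<close> by (simp add: ennreal_mult_top)
    qed
    then show "ennreal a * emeasure lborel {s. 0 < s \<and> ennreal (a * s) < u} = u"
       "ennreal a * emeasure lborel {s. 0 < s \<and> ennreal (a * s) \<le> u} = u" by auto
  qed
  \<comment> \<open>The layer-cake formula is Fubini on the region below the graph; an abstract
    \<open>R\<close> serves the strict and the non-strict version at once.\<close>
  have *: "(\<integral>\<^sup>+x. f x \<partial>lborel) = ennreal a * (\<integral>\<^sup>+s. emeasure lborel {x. R s (f x)} * indicator {0<..} s \<partial>lborel)"
    if [measurable]: "Measurable.pred (borel \<Otimes>\<^sub>M borel) (\<lambda>(x, s). R s (f x))"
      and R: "\<And>u. ennreal a * emeasure lborel {s. 0 < s \<and> R s u} = u" for R :: "real \<Rightarrow> ennreal \<Rightarrow> bool"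
  proof -
    have m1[measurable]: "{s. 0 < s \<and> R s (f x)} \<in> sets borel" for x :: real
    proof -
      have "(\<lambda>s. (x, s)) \<in> borel \<rightarrow>\<^sub>M borel \<Otimes>\<^sub>M borel" by simp
      from measurable_compose[OF this that(1)] have [measurable]: "Measurable.pred borel (\<lambda>s. R s (f x))" by simp
      show ?thesis by measurable
    qed
    have m2[measurable]: "{x. R s (f x)} \<in> sets borel" for s :: real
    proof -
      have "(\<lambda>x. (x, s)) \<in> borel \<rightarrow>\<^sub>M borel \<Otimes>\<^sub>M borel" by simp
      from measurable_compose[OF this that(1)] have [measurable]: "Measurable.pred borel (\<lambda>x. R s (f x))" by simp
      show ?thesis by measurable
    qed
    have "(\<integral>\<^sup>+x. f x \<partial>lborel) = (\<integral>\<^sup>+x. ennreal a * emeasure lborel {s. 0 < s \<and> R s (f x)} \<partial>lborel)"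
      by (simp add: R)
    also have "\<dots> = (\<integral>\<^sup>+x. ennreal a * (\<integral>\<^sup>+s. indicator {(x,s). 0 < s \<and> R s (f x)} (x, s) \<partial>lborel) \<partial>lborel)"
    proof (intro nn_integral_cong arg_cong2[where f="(*)"] refl)
      fix x :: real
      have "(\<lambda>s. indicator {(x,s). 0 < s \<and> R s (f x)} (x, s)) = (indicator {s. 0 < s \<and> R s (f x)} :: real \<Rightarrow> ennreal)"
        by (auto simp: indicator_def)
      then show "emeasure lborel {s. 0 < s \<and> R s (f x)}
          = (\<integral>\<^sup>+s. indicator {(x,s). 0 < s \<and> R s (f x)} (x, s) \<partial>lborel)"
        by simp
    qed
    also have "\<dots> = ennreal a * (\<integral>\<^sup>+x. (\<integral>\<^sup>+s. indicator {(x,s). 0 < s \<and> R s (f x)} (x, s) \<partial>lborel) \<partial>lborel)"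
      by (rule nn_integral_cmult) measurable
    also have "(\<integral>\<^sup>+x. (\<integral>\<^sup>+s. indicator {(x,s). 0 < s \<and> R s (f x)} (x, s) \<partial>lborel) \<partial>lborel)
        = (\<integral>\<^sup>+s. (\<integral>\<^sup>+x. indicator {(x,s). 0 < s \<and> R s (f x)} (x, s) \<partial>lborel) \<partial>lborel)"
      by (rule lborel_pair.Fubini'[symmetric]) measurable
    also have "\<dots> = (\<integral>\<^sup>+s. (\<integral>\<^sup>+x. indicator {x. R s (f x)} x * indicator {0<..} s \<partial>lborel) \<partial>lborel)"
      by (intro nn_integral_cong) (auto simp: indicator_def)
    also have "\<dots> = (\<integral>\<^sup>+s. emeasure lborel {x. R s (f x)} * indicator {0<..} s \<partial>lborel)"
      by (intro nn_integral_cong) (simp add: nn_integral_multc)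
    finally show ?thesis .
  qed
  show "(\<integral>\<^sup>+x. f x \<partial>lborel) =
      ennreal a * (\<integral>\<^sup>+s. emeasure lborel {x. ennreal (a * s) < f x} * indicator {0<..} s \<partial>lborel)"
    by (rule *) (measurable, rule len)
  show "(\<integral>\<^sup>+x. f x \<partial>lborel) =
      ennreal a * (\<integral>\<^sup>+s. emeasure lborel {x. ennreal (a * s) \<le> f x} * indicator {0<..} s \<partial>lborel)"
    by (rule *) (measurable, rule len)
qed

text \<open>Measuring levels of \<open>f\<close> and \<open>g\<close> in units of their suprema
  \<open>a\<close> and \<open>b\<close> makes both superlevel sets nonempty for exactly the same
  \<open>s\<close>, namely \<open>s < 1\<close>; this is what the sumset inequality requires.
  Boundedness makes the suprema finite, and bounded support makes the superlevel sets
  bounded.\<close>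

lemma Prekopa_Leindler_real_bounded:
  fixes f g h :: "real \<Rightarrow> ennreal" and l C R :: real
  assumes [measurable]: "f \<in> borel_measurable borel" "g \<in> borel_measurable borel" "h \<in> borel_measurable borel"
    and l: "0 < l" "l < 1"
    and geo: "\<And>x y. geo_le l (f x) (g y) (h ((1 - l) * x + l * y))"
    and bd: "\<And>x. f x \<le> ennreal C" "\<And>x. g x \<le> ennreal C"
    and supp: "\<And>x. f x \<noteq> 0 \<Longrightarrow> \<bar>x\<bar> \<le> R" "\<And>x. g x \<noteq> 0 \<Longrightarrow> \<bar>x\<bar> \<le> R"
  shows "geo_le l (\<integral>\<^sup>+x. f x \<partial>lborel) (\<integral>\<^sup>+x. g x \<partial>lborel) (\<integral>\<^sup>+x. h x \<partial>lborel)"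
  unfolding geo_le_def
proof (intro allI impI)
  fix p q :: real
  assume pq: "0 < p" "0 < q" "ennreal p < (\<integral>\<^sup>+x. f x \<partial>lborel)" "ennreal q < (\<integral>\<^sup>+x. g x \<partial>lborel)"
  have sup: "\<exists>a>0. (SUP x. u x) = ennreal a"
    if u: "\<And>x. u x \<le> ennreal C" "ennreal r < (\<integral>\<^sup>+x. u x \<partial>lborel)" for u :: "real \<Rightarrow> ennreal" and r
  proof -
    have "(SUP x. u x) \<le> ennreal C" using u by (intro SUP_least)
    then obtain a where a: "(SUP x. u x) = ennreal a" "0 \<le> a"
      by (cases "SUP x. u x") (auto simp: top_unique)
    have "a \<noteq> 0"
    proof
      assume "a = 0"
      then have "u x = 0" for x using a SUP_upper[of x UNIV u] by simp
      with u show False by simp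
    qed
    with a show ?thesis by (intro exI[of _ a]) auto
  qed
  obtain a where a: "0 < a" "(SUP x. f x) = ennreal a" using sup[OF bd(1) pq(3)] by auto
  obtain b where b: "0 < b" "(SUP x. g x) = ennreal b" using sup[OF bd(2) pq(4)] by auto
  define c where "c = a powr (1 - l) * b powr l"
  have "0 < c" using a b by (simp add: c_def)
  let ?A = "\<lambda>s. {x. ennreal (a * s) < f x}" and ?B = "\<lambda>s. {x. ennreal (b * s) < g x}"
    and ?C = "\<lambda>s. {x. ennreal (c * s) \<le> h x}"
  have level: "ennreal (1 - l) * emeasure lborel (?A s) + ennreal l * emeasure lborel (?B s) \<le> emeasure lborel (?C s)"
    if s: "0 < s" for s
  proof (cases "s < 1")
    case False
    have "f x \<le> ennreal a" "g x \<le> ennreal b" for x using a b SUP_upper[of x UNIV f] SUP_upper[of x UNIV g] by simp_all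
    moreover have "ennreal a \<le> ennreal (a * s)" "ennreal b \<le> ennreal (b * s)"
      using False a b by (auto intro!: ennreal_leI)
    ultimately have "?A s = {}" "?B s = {}" by (auto simp: not_less intro: order_trans)
    then show ?thesis by simp
  next
    case True
    let ?A' = "(\<lambda>x. x / (1 - l)) -` ?A s" and ?B' = "(\<lambda>x. x / l) -` ?B s"
    have "ennreal (a * s) < (SUP x. f x)" "ennreal (b * s) < (SUP x. g x)"
      using True a b s by (auto simp: ennreal_less_iff)
    then obtain x0 y0 where "x0 \<in> ?A s" "y0 \<in> ?B s" by (auto simp: less_SUP_iff)
    then have ne: "(1 - l) * x0 \<in> ?A'" "l * y0 \<in> ?B'" using l by auto
    have "emeasure lborel ?A' + emeasure lborel ?B' \<le> emeasure lborel (?C s)"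
    proof (rule Brunn_Minkowski_real)
      show "?A' \<in> sets borel" "?B' \<in> sets borel"
        by (rule measurable_sets_borel[of _ borel]; measurable)+
      show "?C s \<in> sets borel" by measurable
      show "?A' \<noteq> {}" "?B' \<noteq> {}" using ne by blast+
      have "x \<le> R * (1 - l)" if "x \<in> ?A'" for x
      proof -
        have "f (x / (1 - l)) \<noteq> 0" using that by auto
        then show ?thesis using supp(1)[of "x / (1 - l)"] l by (simp add: abs_le_iff pos_divide_le_eq)
      qed
      then show "bdd_above ?A'" by (rule bdd_aboveI)
      have "- R * l \<le> x" if "x \<in> ?B'" for x
      proof -
        have "g (x / l) \<noteq> 0" using that by auto
        from supp(2)[OF this] have "- R \<le> x / l" using abs_ge_minus_self[of "x / l"] by linarith
        then show ?thesis using l by (simp add: pos_le_divide_eq)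
      qed
      then show "bdd_below ?B'" by (rule bdd_belowI)
      fix x y assume xy: "x \<in> ?A'" "y \<in> ?B'"
      \<comment> \<open>Since \<open>x\<close> and \<open>y\<close> come from dilated superlevel
        sets, \<open>x + y\<close> is a convex combination of points where \<open>f\<close> exceeds
        \<open>a * s\<close> and \<open>g\<close> exceeds \<open>b * s\<close>; the geometric mean
        of these levels is \<open>c * s\<close>.\<close>
      have "geo_le l (f (x / (1 - l))) (g (y / l)) (h (x + y))"
        using geo[of "x / (1 - l)" "y / l"] l by simp
      from geo_leD[OF this, of "a * s" "b * s"] xy a b s
      have "ennreal ((a * s) powr (1 - l) * (b * s) powr l) \<le> h (x + y)" by simp
      moreover have "(a * s) powr (1 - l) * (b * s) powr l = c * (s powr (1 - l) * s powr l)"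
        using a b s by (simp add: c_def powr_mult)
      ultimately show "x + y \<in> ?C s" using s by (simp flip: powr_add)
    qed
    moreover have "emeasure lborel ?A' = ennreal (1 - l) * emeasure lborel (?A s)"
      using l by (intro emeasure_lborel_real_scale) auto
    moreover have "emeasure lborel ?B' = ennreal l * emeasure lborel (?B s)"
      using l by (intro emeasure_lborel_real_scale) auto
    ultimately show ?thesis by (simp only:)
  qed
  let ?fa = "\<integral>\<^sup>+s. emeasure lborel (?A s) * indicator {0<..} s \<partial>lborel"
  let ?gb = "\<integral>\<^sup>+s. emeasure lborel (?B s) * indicator {0<..} s \<partial>lborel"
  have quot: "ennreal (r / d) \<le> I" if "0 < d" "0 < r" "ennreal r < ennreal d * I" for r d I
  proof (cases I)
    case (real i)
    then have "ennreal r < ennreal (d * i)" using that by (simp add: ennreal_mult)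
    then have "r < d * i" using that by (simp add: ennreal_less_iff)
    then show ?thesis using real that by (auto simp: field_simps intro!: ennreal_leI)
  qed simp
  have fa: "ennreal (p / a) \<le> ?fa"
    using pq a by (intro quot) (simp_all add: nn_integral_superlevel(1)[of f a, symmetric])
  have gb: "ennreal (q / b) \<le> ?gb"
    using pq b by (intro quot) (simp_all add: nn_integral_superlevel(1)[of g b, symmetric])
  have [measurable]: "(\<lambda>s. emeasure lborel (?A s)) \<in> borel_measurable borel" "(\<lambda>s. emeasure lborel (?B s)) \<in> borel_measurable borel"
    by measurable
  \<comment> \<open>Only after division by \<open>a\<close> and \<open>b\<close> can the geometric
    mean be replaced by the arithmetic one, which matches the additive bound in
    \<open>level\<close>; the factor \<open>c\<close> returns with the layer-cake formula for
    \<open>h\<close>.\<close>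
  have "p powr (1 - l) * q powr l = c * ((p / a) powr (1 - l) * (q / b) powr l)"
    using a b pq by (simp add: c_def powr_divide)
  also have "\<dots> \<le> c * ((1 - l) * (p / a) + l * (q / b))"
    using a b pq l \<open>0 < c\<close> by (intro mult_left_mono powr_geo_mean_le_arith_mean) auto
  finally have "ennreal (p powr (1 - l) * q powr l) \<le> ennreal c * (ennreal (1 - l) * ennreal (p / a) + ennreal l * ennreal (q / b))"
    using a b pq l \<open>0 < c\<close> by (simp add: ennreal_leI flip: ennreal_mult ennreal_plus)
  also have "\<dots> \<le> ennreal c * (ennreal (1 - l) * ?fa + ennreal l * ?gb)"
    using fa gb by (intro mult_left_mono add_mono) auto
  also have "\<dots> = ennreal c * (\<integral>\<^sup>+s. (ennreal (1 - l) * emeasure lborel (?A s) + ennreal l * emeasure lborel (?B s)) * indicator {0<..} s \<partial>lborel)"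
    by (simp add: distrib_right nn_integral_add nn_integral_cmult mult.assoc)
  also have "\<dots> \<le> ennreal c * (\<integral>\<^sup>+s. emeasure lborel (?C s) * indicator {0<..} s \<partial>lborel)"
    using level by (intro mult_left_mono nn_integral_mono) (auto simp: indicator_def)
  also have "\<dots> = (\<integral>\<^sup>+x. h x \<partial>lborel)"
    using \<open>0 < c\<close> by (simp add: nn_integral_superlevel(2)[of h c])
  finally show "ennreal (p powr (1 - l) * q powr l) \<le> (\<integral>\<^sup>+x. h x \<partial>lborel)" .
qed

text \<open>Because \<open>geo_le\<close> asks only about \<open>p\<close> and \<open>q\<close>
  strictly below the integrals, monotone convergence lets single truncations of \<open>f\<close> and
  \<open>g\<close> do for each pair. Truncation lowers \<open>f\<close> and \<open>g\<close> alone,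
  so the hypothesis survives with the same \<open>h\<close>.\<close>

lemma Prekopa_Leindler_real:
  fixes f g h :: "real \<Rightarrow> ennreal" and l :: real
  assumes [measurable]: "f \<in> borel_measurable borel" "g \<in> borel_measurable borel" "h \<in> borel_measurable borel"
    and l: "0 < l" "l < 1"
    and geo: "\<And>x y. geo_le l (f x) (g y) (h ((1 - l) * x + l * y))"
  shows "geo_le l (\<integral>\<^sup>+x. f x \<partial>lborel) (\<integral>\<^sup>+x. g x \<partial>lborel) (\<integral>\<^sup>+x. h x \<partial>lborel)"
  unfolding geo_le_def
proof (intro allI impI)
  fix p q :: real
  assume pq: "0 < p" "0 < q" "ennreal p < (\<integral>\<^sup>+x. f x \<partial>lborel)" "ennreal q < (\<integral>\<^sup>+x. g x \<partial>lborel)"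
  define tr :: "(real \<Rightarrow> ennreal) \<Rightarrow> nat \<Rightarrow> real \<Rightarrow> ennreal"
    where "tr u k x = min (u x) (of_nat k) * indicator {- real k..real k} x" for u k x
  have tr_le: "tr u k x \<le> u x" for u k x by (simp add: tr_def indicator_def)
  have inc: "incseq (tr u)" for u
    unfolding tr_def incseq_def le_fun_def
  proof (intro allI impI mult_mono)
    fix m n :: nat and x :: real assume "m \<le> n"
    then show "min (u x) (of_nat m) \<le> min (u x) (of_nat n)" by (intro min.mono) auto
    show "indicator {- real m..real m} x \<le> (indicator {- real n..real n} x :: ennreal)"
      using \<open>m \<le> n\<close> by (auto simp: indicator_def)
  qed auto
  have SUP: "(SUP k. tr u k x) = u x" for u x
  proof (rule antisym)
    show "(SUP k. tr u k x) \<le> u x" using tr_le by (intro SUP_least)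
    show "u x \<le> (SUP k. tr u k x)"
    proof (rule dense_le)
      fix y assume "y < u x"
      obtain m :: nat where m: "y < of_nat m" using \<open>y < u x\<close>
        by (metis ennreal_Ex_less_of_nat order_less_le_trans top_greatest)
      obtain n :: nat where n: "\<bar>x\<bar> \<le> real n" using real_arch_simple by blast
      have "y \<le> tr u (max m n) x" using m n \<open>y < u x\<close>
        by (auto simp: tr_def indicator_def abs_le_iff le_max_iff_disj of_nat_max min_def)
      also have "\<dots> \<le> (SUP k. tr u k x)" by (rule SUP_upper) simp
      finally show "y \<le> (SUP k. tr u k x)" .
    qed
  qed
  have ex: "\<exists>k. ennreal r < (\<integral>\<^sup>+x. tr u k x \<partial>lborel)"
    if [measurable]: "u \<in> borel_measurable borel" and r: "ennreal r < (\<integral>\<^sup>+x. u x \<partial>lborel)" for u r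
  proof -
    have "(\<integral>\<^sup>+x. u x \<partial>lborel) = (\<integral>\<^sup>+x. (SUP k. tr u k x) \<partial>lborel)" by (simp add: SUP)
    also have "\<dots> = (SUP k. \<integral>\<^sup>+x. tr u k x \<partial>lborel)"
      by (rule nn_integral_monotone_convergence_SUP[OF inc]) (unfold tr_def, measurable)
    finally show ?thesis using r by (simp add: less_SUP_iff)
  qed
  obtain i where i: "ennreal p < (\<integral>\<^sup>+x. tr f i x \<partial>lborel)" using ex[OF _ pq(3)] by auto
  obtain j where j: "ennreal q < (\<integral>\<^sup>+x. tr g j x \<partial>lborel)" using ex[OF _ pq(4)] by auto
  have tr_bd: "tr u k x \<le> ennreal (max i j)" if "k \<le> max i j" for u k x
  proof -
    have "tr u k x \<le> of_nat k" by (simp add: tr_def indicator_def)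
    also have "\<dots> \<le> of_nat (max i j)" using that by simp
    finally show ?thesis by (simp add: ennreal_of_nat_eq_real_of_nat)
  qed
  have tr_supp: "\<bar>x\<bar> \<le> real (max i j)" if "k \<le> max i j" "tr u k x \<noteq> 0" for u k x
    using that by (auto simp: tr_def indicator_def abs_le_iff split: if_splits)
  have "geo_le l (\<integral>\<^sup>+x. tr f i x \<partial>lborel) (\<integral>\<^sup>+x. tr g j x \<partial>lborel) (\<integral>\<^sup>+x. h x \<partial>lborel)"
  proof (rule Prekopa_Leindler_real_bounded[OF _ _ _ l, where C="real (max i j)" and R="real (max i j)"])
    show "tr f i \<in> borel_measurable borel" "tr g j \<in> borel_measurable borel"
      unfolding tr_def by measurable
    show "geo_le l (tr f i x) (tr g j y) (h ((1 - l) * x + l * y))" for x y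
      using geo by (rule geo_le_mono) (rule tr_le)+
  qed (auto intro: tr_bd simp del: of_nat_max dest: tr_supp[rotated])
  from geo_leD[OF this pq(1,2) i j]
  show "ennreal (p powr (1 - l) * q powr l) \<le> (\<integral>\<^sup>+x. h x \<partial>lborel)" .
qed

text \<open>Induction on the coordinates: integrating out the new coordinate by the one-dimensional
  case yields three functions of the remaining coordinates that again satisfy the hypothesis. Points
  are taken \<open>extensional\<close> to match the space of the product measure.\<close>

lemma Prekopa_Leindler_PiM:
  fixes f g h :: "('i \<Rightarrow> real) \<Rightarrow> ennreal" and l :: real
  assumes "finite I"
    and "f \<in> borel_measurable (PiM I (\<lambda>_. lborel))" "g \<in> borel_measurable (PiM I (\<lambda>_. lborel))"
      "h \<in> borel_measurable (PiM I (\<lambda>_. lborel))"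
    and l: "0 < l" "l < 1"
    and "\<And>x y. x \<in> extensional I \<Longrightarrow> y \<in> extensional I \<Longrightarrow>
      geo_le l (f x) (g y) (h (\<lambda>i\<in>I. (1 - l) * x i + l * y i))"
  shows "geo_le l (\<integral>\<^sup>+x. f x \<partial>PiM I (\<lambda>_. lborel)) (\<integral>\<^sup>+x. g x \<partial>PiM I (\<lambda>_. lborel))
    (\<integral>\<^sup>+x. h x \<partial>PiM I (\<lambda>_. lborel))"
  using assms(1-4,7)
proof (induction I arbitrary: f g h rule: finite_induct)
  case empty
  from empty.prems(4)[of "\<lambda>_. undefined" "\<lambda>_. undefined"] show ?case
    by (simp add: PiM_empty nn_integral_count_space_finite extensional_def restrict_def)
next
  case (insert i I)
  interpret product_sigma_finite "\<lambda>_::'i. lborel :: real measure" by standard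
  note [measurable] = insert.prems(1-3)
  have upd: "(\<lambda>(x, y). x(i := y)) \<in> PiM I (\<lambda>_. lborel) \<Otimes>\<^sub>M lborel \<rightarrow>\<^sub>M PiM (insert i I) (\<lambda>_. lborel :: real measure)"
    by (rule measurable_add_dim)
  have meas: "(\<lambda>x. \<integral>\<^sup>+y. u (x(i := y)) \<partial>lborel) \<in> borel_measurable (PiM I (\<lambda>_. lborel))"
    if "u \<in> borel_measurable (PiM (insert i I) (\<lambda>_. lborel :: real measure))" for u :: "_ \<Rightarrow> ennreal"
  proof -
    have [measurable]: "(\<lambda>(x, y). u (x(i := y))) \<in> borel_measurable (PiM I (\<lambda>_. lborel) \<Otimes>\<^sub>M lborel)"
      using measurable_compose[OF upd that] by (simp add: case_prod_beta')
    show ?thesis by measurable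
  qed
  have sec: "(\<lambda>y. u (x(i := y))) \<in> borel_measurable borel"
    if "u \<in> borel_measurable (PiM (insert i I) (\<lambda>_. lborel :: real measure))" "x \<in> extensional I" for u :: "_ \<Rightarrow> ennreal" and x
  proof -
    have "(\<lambda>y. (x, y)) \<in> (lborel :: real measure) \<rightarrow>\<^sub>M PiM I (\<lambda>_. lborel) \<Otimes>\<^sub>M lborel"
      using that(2) by (intro measurable_Pair1') (auto simp: space_PiM PiE_def)
    from measurable_compose[OF measurable_compose[OF this upd] that(1)] show ?thesis by simp
  qed
  have "geo_le l (\<integral>\<^sup>+x. (\<integral>\<^sup>+y. f (x(i := y)) \<partial>lborel) \<partial>PiM I (\<lambda>_. lborel))
      (\<integral>\<^sup>+x. (\<integral>\<^sup>+y. g (x(i := y)) \<partial>lborel) \<partial>PiM I (\<lambda>_. lborel))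
      (\<integral>\<^sup>+x. (\<integral>\<^sup>+y. h (x(i := y)) \<partial>lborel) \<partial>PiM I (\<lambda>_. lborel))"
  proof (rule insert.IH)
    fix x y :: "'i \<Rightarrow> real" assume xy: "x \<in> extensional I" "y \<in> extensional I"
    let ?z = "\<lambda>j\<in>I. (1 - l) * x j + l * y j"
    show "geo_le l (\<integral>\<^sup>+s. f (x(i := s)) \<partial>lborel) (\<integral>\<^sup>+s. g (y(i := s)) \<partial>lborel) (\<integral>\<^sup>+s. h (?z(i := s)) \<partial>lborel)"
    proof (rule Prekopa_Leindler_real[OF _ _ _ l])
      fix s t :: real
      have "(\<lambda>j\<in>insert i I. (1 - l) * (x(i := s)) j + l * (y(i := t)) j) = ?z(i := (1 - l) * s + l * t)"
        using insert.hyps by (auto simp: restrict_def fun_eq_iff)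
      moreover have "x(i := s) \<in> extensional (insert i I)" "y(i := t) \<in> extensional (insert i I)"
        using xy by (auto simp: extensional_def)
      ultimately show "geo_le l (f (x(i := s))) (g (y(i := t))) (h (?z(i := (1 - l) * s + l * t)))"
        using insert.prems(4)[of "x(i := s)" "y(i := t)"] by (simp only:)
    qed (use xy insert.prems in \<open>auto intro!: sec\<close>)
  qed (intro meas insert.prems)+
  then show ?case using insert.hyps by (simp add: product_nn_integral_insert)
qed

theorem Prekopa_Leindler:
  fixes f g h :: "'a::euclidean_space \<Rightarrow> ennreal" and l :: real
  assumes [measurable]: "f \<in> borel_measurable borel" "g \<in> borel_measurable borel" "h \<in> borel_measurable borel"
    and l: "0 < l" "l < 1"
    and geo: "\<And>x y. geo_le l (f x) (g y) (h ((1 - l) *\<^sub>R x + l *\<^sub>R y))"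
  shows "geo_le l (\<integral>\<^sup>+x. f x \<partial>lborel) (\<integral>\<^sup>+x. g x \<partial>lborel) (\<integral>\<^sup>+x. h x \<partial>lborel)"
proof -
  let ?P = "PiM (Basis :: 'a set) (\<lambda>_. lborel :: real measure)"
  let ?\<phi> = "\<lambda>u. \<Sum>b\<in>Basis. u b *\<^sub>R (b :: 'a)"
  have \<phi>[measurable]: "?\<phi> \<in> ?P \<rightarrow>\<^sub>M borel" by measurable
  have lb: "(lborel :: 'a measure) = distr ?P borel ?\<phi>"
    by (subst lborel_def) (simp add: lborel_eq_real)
  have int: "(\<integral>\<^sup>+x. u x \<partial>lborel) = (\<integral>\<^sup>+x. u (?\<phi> x) \<partial>?P)"
    if [measurable]: "u \<in> borel_measurable borel" for u :: "'a \<Rightarrow> ennreal"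
    by (subst lb) (simp add: nn_integral_distr)
  have "geo_le l (\<integral>\<^sup>+x. f (?\<phi> x) \<partial>?P) (\<integral>\<^sup>+x. g (?\<phi> x) \<partial>?P) (\<integral>\<^sup>+x. h (?\<phi> x) \<partial>?P)"
  proof (rule Prekopa_Leindler_PiM[OF _ _ _ _ l])
    fix x y :: "'a \<Rightarrow> real"
    have "?\<phi> (\<lambda>i\<in>Basis. (1 - l) * x i + l * y i) = (1 - l) *\<^sub>R ?\<phi> x + l *\<^sub>R ?\<phi> y"
      by (simp add: scaleR_sum_right scaleR_add_left sum.distrib)
    then show "geo_le l (f (?\<phi> x)) (g (?\<phi> y)) (h (?\<phi> (\<lambda>i\<in>Basis. (1 - l) * x i + l * y i)))"
      using geo by simp
  qed auto
  then show ?thesis by (simp add: int)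
qed

section \<open>Comparing moments of a log-concave function with those of an exponential\<close>

lemma nn_integral_powr_exp:
  fixes s c :: real
  assumes "0 < s" "0 < c"
  shows "(\<integral>\<^sup>+t. ennreal (t powr (s - 1) * exp (- (c * t))) * indicator {0<..} t \<partial>lborel) = ennreal (Gamma s / c powr s)"
proof -
  let ?F = "\<lambda>t::real. ennreal (indicator {0..} t * t powr (s - 1) / exp t)"
  have "ennreal (Gamma s) = (\<integral>\<^sup>+t. ?F t \<partial>lborel)"
    using assms Gamma_conv_nn_integral_real by simp
  also have "\<dots> = ennreal c * (\<integral>\<^sup>+t. ?F (0 + c * t) \<partial>lborel)"
    using assms by (subst nn_integral_real_affine[where c=c and t=0]) auto
  also have "(\<integral>\<^sup>+t. ?F (0 + c * t) \<partial>lborel) =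
      (\<integral>\<^sup>+t. ennreal (c powr (s - 1)) * (ennreal (t powr (s - 1) * exp (- (c * t))) * indicator {0<..} t) \<partial>lborel)"
    using assms by (intro nn_integral_cong)
      (auto simp: indicator_def powr_mult exp_minus field_simps zero_le_mult_iff simp flip: ennreal_mult)
  also have "\<dots> = ennreal (c powr (s - 1)) * (\<integral>\<^sup>+t. ennreal (t powr (s - 1) * exp (- (c * t))) * indicator {0<..} t \<partial>lborel)"
    by (rule nn_integral_cmult) simp
  finally have eq: "ennreal (Gamma s) = ennreal (c powr s) * (\<integral>\<^sup>+t. ennreal (t powr (s - 1) * exp (- (c * t))) * indicator {0<..} t \<partial>lborel)"
    using assms by (simp add: powr_diff flip: ennreal_mult mult.assoc)
  have "ennreal (1 / c powr s) * ennreal (Gamma s)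
     = (\<integral>\<^sup>+t. ennreal (t powr (s - 1) * exp (- (c * t))) * indicator {0<..} t \<partial>lborel)"
    unfolding eq using assms by (simp flip: mult.assoc ennreal_mult)
  then show ?thesis using assms Gamma_real_pos[of s] by (simp flip: ennreal_mult)
qed

text \<open>If the two weighted integrals agree for the smaller exponent, the function and the
  exponential through the same value at the origin cross once, from above to below; weighting by
  the difference of the powers at the crossing point then yields the inequality.\<close>

lemma log_concave_moment_comparison:
  fixes \<phi> :: "real \<Rightarrow> real" and \<alpha> \<beta> m :: real
  assumes [measurable]: "\<phi> \<in> borel_measurable borel"
    and nonneg: "\<And>t. 0 \<le> \<phi> t" and pos: "0 < \<phi> 0"
    and lc: "\<And>t l. 0 < t \<Longrightarrow> 0 < l \<Longrightarrow> l < 1 \<Longrightarrow> \<phi> 0 powr (1 - l) * \<phi> t powr l \<le> \<phi> (l * t)"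
    and ab: "0 < \<beta>" "\<beta> < \<alpha>"
    and m: "0 \<le> m" "(\<integral>\<^sup>+t. ennreal (t powr (\<beta> - 1) * \<phi> t) * indicator {0<..} t \<partial>lborel) = ennreal m"
  shows "(\<integral>\<^sup>+t. ennreal (t powr (\<alpha> - 1) * \<phi> t) * indicator {0<..} t \<partial>lborel)
    \<le> ennreal (Gamma \<alpha> * \<phi> 0 * (m / (Gamma \<beta> * \<phi> 0)) powr (\<alpha> / \<beta>))"
proof (cases "m = 0")
  case True
  \<comment> \<open>With \<open>m = 0\<close> the rate of the comparison exponential below would
    involve a division by 0; here \<open>\<phi>\<close> simply vanishes almost everywhere on the
    half-line.\<close>
  then have "AE t in lborel. ennreal (t powr (\<beta> - 1) * \<phi> t) * indicator {0<..} t = 0"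
    using m by (subst nn_integral_0_iff_AE[symmetric]) auto
  then have "AE t in lborel. ennreal (t powr (\<alpha> - 1) * \<phi> t) * indicator {0<..} t = 0"
  proof eventually_elim
    case (elim t)
    then show ?case using nonneg[of t]
      by (auto simp: indicator_def ennreal_eq_0_iff mult_le_0_iff split: if_splits)
  qed
  then have "(\<integral>\<^sup>+t. ennreal (t powr (\<alpha> - 1) * \<phi> t) * indicator {0<..} t \<partial>lborel) = (\<integral>\<^sup>+t. 0 \<partial>(lborel::real measure))"
    by (rule nn_integral_cong_AE)
  then show ?thesis by simp
next
  case False
  with m have "0 < m" by simp
  have G: "0 < Gamma \<beta>" "0 < Gamma \<alpha>" using ab by (auto intro!: Gamma_real_pos)
  define M where "M = \<phi> 0"
  \<comment> \<open>The rate is the solution of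
    \<open>M * Gamma \<beta> / c powr \<beta> = m\<close>, so that \<open>e\<close> has the same
    weighted integral as \<open>\<phi>\<close> for the exponent \<open>\<beta>\<close>.\<close>
  define c where "c = (Gamma \<beta> * M / m) powr (1 / \<beta>)"
  define e where "e t = M * exp (- (c * t))" for t
  have "0 < M" using pos by (simp add: M_def)
  have "0 < c" using G \<open>0 < m\<close> \<open>0 < M\<close> by (simp add: c_def)
  have [measurable]: "e \<in> borel_measurable borel" unfolding e_def by measurable
  have e_pos: "0 < e t" for t using \<open>0 < M\<close> by (simp add: e_def)
  have int_e: "(\<integral>\<^sup>+t. ennreal (t powr (s - 1) * e t) * indicator {0<..} t \<partial>lborel) = ennreal (M * (Gamma s / c powr s))"
    if "0 < s" for s
  proof -
    have "(\<integral>\<^sup>+t. ennreal (t powr (s - 1) * e t) * indicator {0<..} t \<partial>lborel)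
      = (\<integral>\<^sup>+t. ennreal M * (ennreal (t powr (s - 1) * exp (- (c * t))) * indicator {0<..} t) \<partial>lborel)"
    proof (intro nn_integral_cong)
      fix t :: real
      have "t powr (s - 1) * e t = M * (t powr (s - 1) * exp (- (c * t)))" by (simp add: e_def)
      then show "ennreal (t powr (s - 1) * e t) * indicator {0<..} t
          = ennreal M * (ennreal (t powr (s - 1) * exp (- (c * t))) * indicator {0<..} t)"
        using \<open>0 < M\<close> by (simp only: ennreal_mult' less_imp_le mult.assoc)
    qed
    also have "\<dots> = ennreal M * ennreal (Gamma s / c powr s)"
      using that \<open>0 < c\<close> by (simp add: nn_integral_cmult nn_integral_powr_exp)
    finally show ?thesis using that \<open>0 < M\<close> Gamma_real_pos[OF that] by (simp flip: ennreal_mult)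
  qed
  have "c powr \<beta> = Gamma \<beta> * M / m"
    using G \<open>0 < m\<close> \<open>0 < M\<close> ab by (simp add: c_def powr_powr)
  then have int_eb: "(\<integral>\<^sup>+t. ennreal (t powr (\<beta> - 1) * e t) * indicator {0<..} t \<partial>lborel) = ennreal m"
    using int_e[of \<beta>] ab G \<open>0 < M\<close> by simp
  have ca: "M * (Gamma \<alpha> / c powr \<alpha>) = Gamma \<alpha> * M * (m / (Gamma \<beta> * M)) powr (\<alpha> / \<beta>)"
  proof -
    have "c powr \<alpha> = (Gamma \<beta> * M / m) powr (\<alpha> / \<beta>)" by (simp add: c_def powr_powr)
    moreover have "(m / (Gamma \<beta> * M)) powr (\<alpha> / \<beta>) = 1 / (Gamma \<beta> * M / m) powr (\<alpha> / \<beta>)"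
      using G \<open>0 < m\<close> \<open>0 < M\<close> by (simp add: powr_divide)
    ultimately show ?thesis by simp
  qed
  \<comment> \<open>Along the ray \<open>ln e\<close> is affine and agrees with
    \<open>ln \<phi>\<close> at 0, so log-concavity makes \<open>S\<close> closed downwards; its
    supremum is the crossing point.\<close>
  define S where "S = {t. 0 < t \<and> e t \<le> \<phi> t}"
  have down: "s \<in> S" if "t \<in> S" "0 < s" "s < t" for s t
  proof -
    have t: "0 < t" "e t \<le> \<phi> t" using that by (auto simp: S_def)
    have "e s = M powr (1 - s / t) * e t powr (s / t)"
    proof -
      have "M powr (1 - s / t) * e t powr (s / t) = (M powr (1 - s / t) * M powr (s / t)) * exp (- (c * t)) powr (s / t)"
        using \<open>0 < M\<close> by (simp add: e_def powr_mult)
      also have "\<dots> = M * exp (- (c * s))"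
        using \<open>0 < M\<close> t by (simp add: exp_powr_real flip: powr_add)
      finally show ?thesis by (simp add: e_def)
    qed
    also have "\<dots> \<le> M powr (1 - s / t) * \<phi> t powr (s / t)"
      using t that e_pos[of t] by (intro mult_left_mono powr_mono2) auto
    also have "\<dots> \<le> \<phi> (s / t * t)"
      unfolding M_def using t that by (intro lc) auto
    finally show ?thesis using that t by (simp add: S_def)
  qed
  have main: "(\<integral>\<^sup>+t. ennreal (t powr (\<alpha> - 1) * \<phi> t) * indicator {0<..} t \<partial>lborel)
     \<le> (\<integral>\<^sup>+t. ennreal (t powr (\<alpha> - 1) * e t) * indicator {0<..} t \<partial>lborel)"
  proof (cases "bdd_above S")
    case True
    define t0 where "t0 = (if S = {} then 0 else Sup S)"
    have t0: "0 \<le> t0"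
    proof (cases "S = {}")
      case False
      then obtain s where "s \<in> S" by blast
      with cSup_upper[OF this True] False show ?thesis by (auto simp: t0_def S_def)
    qed (simp add: t0_def)
    have above: "e t \<le> \<phi> t" if "0 < t" "t < t0" for t
    proof -
      have "S \<noteq> {}" using that by (auto simp: t0_def)
      with that obtain s where "s \<in> S" "t < s" by (auto simp: t0_def less_cSup_iff[OF _ True])
      from down[OF this(1) that(1) this(2)] show ?thesis by (simp add: S_def)
    qed
    have below: "\<phi> t \<le> e t" if "t0 < t" for t
    proof (rule ccontr)
      assume "\<not> \<phi> t \<le> e t"
      then have "t \<in> S" using that t0 by (simp add: S_def)
      then have "t \<le> t0" using cSup_upper[OF _ True] by (auto simp: t0_def)
      with that show False by simp
    qed
    define k where "k = t0 powr (\<alpha> - \<beta>)"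
    have "0 \<le> k" by (simp add: k_def)
    \<comment> \<open>This is
      \<open>(t powr (\<alpha> - \<beta>) - k) * (\<phi> t - e t) \<le> 0\<close>, rearranged into
      sums of nonnegative terms. It can then be integrated in \<open>ennreal\<close>, where the
      common finite term \<open>k * m\<close> cancels.\<close>
    have pw: "t powr (\<alpha> - 1) * \<phi> t + k * (t powr (\<beta> - 1) * e t) \<le> t powr (\<alpha> - 1) * e t + k * (t powr (\<beta> - 1) * \<phi> t)"
      if "0 < t" "t \<noteq> t0" for t
    proof -
      have "(t powr (\<alpha> - \<beta>) - k) * (\<phi> t - e t) \<le> 0"
      proof (cases "t < t0")
        case True
        then have "t powr (\<alpha> - \<beta>) \<le> k" unfolding k_def using that ab by (intro powr_mono2) auto
        with above[OF that(1) True] show ?thesis by (intro mult_nonpos_nonneg) auto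
      next
        case False
        then have "k \<le> t powr (\<alpha> - \<beta>)" unfolding k_def using t0 ab by (intro powr_mono2) auto
        with below[of t] False that show ?thesis by (intro mult_nonneg_nonpos) auto
      qed
      then have "t powr (\<beta> - 1) * ((t powr (\<alpha> - \<beta>) - k) * (\<phi> t - e t)) \<le> 0"
        by (simp add: mult_nonneg_nonpos)
      moreover have "t powr (\<alpha> - 1) = t powr (\<beta> - 1) * t powr (\<alpha> - \<beta>)"
        by (simp flip: powr_add)
      ultimately show ?thesis by (simp add: algebra_simps)
    qed
    let ?X = "\<integral>\<^sup>+t. ennreal (t powr (\<alpha> - 1) * \<phi> t) * indicator {0<..} t \<partial>lborel"
    let ?E = "\<integral>\<^sup>+t. ennreal (t powr (\<alpha> - 1) * e t) * indicator {0<..} t \<partial>lborel"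
    have comb: "(\<integral>\<^sup>+t. ennreal (t powr (\<alpha> - 1) * u t) * indicator {0<..} t + ennreal k * (ennreal (t powr (\<beta> - 1) * v t) * indicator {0<..} t) \<partial>lborel)
       = (\<integral>\<^sup>+t. ennreal (t powr (\<alpha> - 1) * u t) * indicator {0<..} t \<partial>lborel)
        + ennreal k * (\<integral>\<^sup>+t. ennreal (t powr (\<beta> - 1) * v t) * indicator {0<..} t \<partial>lborel)"
      if [measurable]: "u \<in> borel_measurable borel" "v \<in> borel_measurable borel" for u v :: "real \<Rightarrow> real"
      by (simp add: nn_integral_add nn_integral_cmult)
    have "?X + ennreal k * ennreal m =
      (\<integral>\<^sup>+t. ennreal (t powr (\<alpha> - 1) * \<phi> t) * indicator {0<..} t + ennreal k * (ennreal (t powr (\<beta> - 1) * e t) * indicator {0<..} t) \<partial>lborel)"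
      by (simp add: comb int_eb)
    also have "\<dots> \<le> (\<integral>\<^sup>+t. ennreal (t powr (\<alpha> - 1) * e t) * indicator {0<..} t + ennreal k * (ennreal (t powr (\<beta> - 1) * \<phi> t) * indicator {0<..} t) \<partial>lborel)"
    proof (rule nn_integral_mono_AE)
      have "AE t in lborel. t \<noteq> t0" by (rule AE_lborel_singleton)
      then show "AE t in lborel. ennreal (t powr (\<alpha> - 1) * \<phi> t) * indicator {0<..} t + ennreal k * (ennreal (t powr (\<beta> - 1) * e t) * indicator {0<..} t)
         \<le> ennreal (t powr (\<alpha> - 1) * e t) * indicator {0<..} t + ennreal k * (ennreal (t powr (\<beta> - 1) * \<phi> t) * indicator {0<..} t)"
      proof eventually_elim
        case (elim t)
        show ?case
        proof (cases "0 < t")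
          case True
          then show ?thesis using pw[OF True elim] nonneg[of t] e_pos[of t] \<open>0 \<le> k\<close>
            by (simp flip: ennreal_mult ennreal_plus)
        qed simp
      qed
    qed
    also have "\<dots> = ?E + ennreal k * ennreal m" by (simp add: comb m)
    finally show ?thesis by (simp add: ennreal_add_left_cancel_le add.commute ennreal_mult_eq_top_iff)
  next
    case False
    \<comment> \<open>An unbounded \<open>S\<close> is the whole open half-line. Then
      \<open>e\<close> lies below \<open>\<phi>\<close> throughout, and the equal finite integrals
      for \<open>\<beta>\<close> force the two to agree almost everywhere.\<close>
    have above: "e t \<le> \<phi> t" if "0 < t" for t
    proof -
      obtain s where "s \<in> S" "t < s" using False unfolding bdd_above_def by (meson not_le)
      from down[OF this(1) that this(2)] show ?thesis by (simp add: S_def)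
    qed
    have "ennreal m = (\<integral>\<^sup>+t. ennreal (t powr (\<beta> - 1) * e t) * indicator {0<..} t + ennreal (t powr (\<beta> - 1) * (\<phi> t - e t)) * indicator {0<..} t \<partial>lborel)"
      unfolding m(2)[symmetric] using e_pos above
      by (intro nn_integral_cong) (auto simp: indicator_def algebra_simps less_imp_le simp flip: ennreal_plus)
    also have "\<dots> = ennreal m + (\<integral>\<^sup>+t. ennreal (t powr (\<beta> - 1) * (\<phi> t - e t)) * indicator {0<..} t \<partial>lborel)"
      by (simp add: nn_integral_add int_eb)
    finally have "(\<integral>\<^sup>+t. ennreal (t powr (\<beta> - 1) * (\<phi> t - e t)) * indicator {0<..} t \<partial>lborel) = 0"
      using ennreal_add_left_cancel[of "ennreal m" 0] by simp
    then have "AE t in lborel. ennreal (t powr (\<beta> - 1) * (\<phi> t - e t)) * indicator {0<..} t = 0"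
      by (subst nn_integral_0_iff_AE[symmetric]) auto
    then have "AE t in lborel. ennreal (t powr (\<alpha> - 1) * \<phi> t) * indicator {0<..} t \<le> ennreal (t powr (\<alpha> - 1) * e t) * indicator {0<..} t"
    proof eventually_elim
      case (elim t)
      then have "0 < t \<Longrightarrow> t powr (\<beta> - 1) * (\<phi> t - e t) \<le> 0" by (simp add: ennreal_eq_0_iff)
      then have "0 < t \<Longrightarrow> \<phi> t \<le> e t" by (simp add: mult_le_0_iff)
      then show ?case by (auto simp: indicator_def intro!: ennreal_leI mult_left_mono)
    qed
    then show ?thesis by (rule nn_integral_mono_AE)
  qed
  also have "\<dots> = ennreal (Gamma \<alpha> * M * (m / (Gamma \<beta> * M)) powr (\<alpha> / \<beta>))"
    using int_e[of \<alpha>] ab ca by simp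
  finally show ?thesis by (simp add: M_def)
qed

section \<open>Polar coordinates through an annulus\<close>

lemma nn_integral_lborel_scaleR:
  fixes f :: "'a::euclidean_space \<Rightarrow> ennreal" and c :: real
  assumes [measurable]: "f \<in> borel_measurable borel" and "0 < c"
  shows "(\<integral>\<^sup>+x. f x \<partial>lborel) = ennreal (c ^ DIM('a)) * (\<integral>\<^sup>+x. f (a + c *\<^sub>R x) \<partial>lborel)"
  using assms by (subst lborel_affine[of c a]) (simp_all add: nn_integral_density nn_integral_distr nn_integral_cmult)

lemma nn_integral_inverse_Ioc:
  fixes r :: real
  assumes "0 < r"
  shows "(\<integral>\<^sup>+t. ennreal (1 / t) * indicator {r / exp 1<..r} t \<partial>lborel) = 1"
proof -
  have "(\<integral>\<^sup>+t. ennreal (1 / t) * indicator {r / exp 1<..r} t \<partial>lborel) = (\<integral>\<^sup>+t. ennreal (1 / t) * indicator {r / exp 1..r} t \<partial>lborel)"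
  proof (rule nn_integral_cong_AE)
    have "AE t in lborel. t \<noteq> r / exp 1" by (rule AE_lborel_singleton)
    then show "AE t in lborel. ennreal (1 / t) * indicator {r / exp 1<..r} t = ennreal (1 / t) * indicator {r / exp 1..r} t"
      by eventually_elim (auto simp: indicator_def)
  qed
  also have "\<dots> = ennreal (ln r - ln (r / exp 1))"
  proof (rule nn_integral_FTC_Icc)
    fix t assume "t \<in> {r / exp 1..r}"
    then have "r / exp 1 \<le> t" by simp
    moreover have "0 < r / exp 1" using assms by simp
    ultimately have "0 < t" by linarith
    then show "(ln has_real_derivative 1 / t) (at t)" "0 \<le> 1 / t"
      by (auto intro!: derivative_eq_intros)
  next
    show "r / exp 1 \<le> r" using assms by (simp add: field_simps)
  qed auto
  also have "\<dots> = 1" using assms by (simp add: ln_div)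
  finally show ?thesis .
qed

lemma nn_integral_powr_Ioc:
  fixes r s :: real
  assumes "0 < s" "0 \<le> r"
  shows "(\<integral>\<^sup>+t. ennreal (t powr (s - 1)) * indicator {0<..r} t \<partial>lborel) = ennreal (r powr s / s)"
proof -
  have "((\<lambda>t. t powr (s - 1)) has_integral (r powr (s - 1 + 1) / (s - 1 + 1))) {0..r}"
    using assms by (intro has_integral_powr_from_0) auto
  then have "((\<lambda>t. t powr (s - 1)) has_integral r powr s / s) {0..r}" by simp
  then have "((\<lambda>t. if t \<in> {0..r} then t powr (s - 1) else 0) has_integral r powr s / s) UNIV"
    by (subst has_integral_restrict_UNIV)
  also have "(\<lambda>t. if t \<in> {0..r} then t powr (s - 1) else 0) = (\<lambda>t. t powr (s - 1) * indicator {0..r} t)"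
    by auto
  finally have "(\<integral>\<^sup>+t. ennreal (t powr (s - 1) * indicator {0..r} t) \<partial>lborel) = ennreal (r powr s / s)"
    by (intro nn_integral_has_integral_lborel) auto
  moreover have "ennreal (t powr (s - 1) * indicator {0..r} t) = ennreal (t powr (s - 1)) * indicator {0<..r} t" for t
    by (auto simp: indicator_def)
  ultimately show ?thesis by simp
qed

text \<open>Integration in polar coordinates without a surface measure: every ray meets the annulus
  in a segment of total weight 1 with respect to dt/t.\<close>

lemma nn_integral_polar_annulus:
  fixes G :: "'a::euclidean_space \<Rightarrow> ennreal"
  assumes [measurable]: "G \<in> borel_measurable borel"
  shows "(\<integral>\<^sup>+x. G x \<partial>lborel) = (\<integral>\<^sup>+x. indicator {x. 1 \<le> norm x \<and> norm x < exp 1} x *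
      (\<integral>\<^sup>+t. ennreal (t powr (real DIM('a) - 1)) * G (t *\<^sub>R x) * indicator {0<..} t \<partial>lborel) \<partial>lborel)"
proof -
  let ?A = "{x::'a. 1 \<le> norm x \<and> norm x < exp 1}"
  have A[measurable]: "?A \<in> sets borel" by measurable
  have "(\<integral>\<^sup>+x. indicator ?A x * (\<integral>\<^sup>+t. ennreal (t powr (real DIM('a) - 1)) * G (t *\<^sub>R x) * indicator {0<..} t \<partial>lborel) \<partial>lborel)
     = (\<integral>\<^sup>+x. (\<integral>\<^sup>+t. indicator ?A x * (ennreal (t powr (real DIM('a) - 1)) * G (t *\<^sub>R x) * indicator {0<..} t) \<partial>lborel) \<partial>lborel)"
    by (simp add: nn_integral_cmult)
  also have "\<dots> = (\<integral>\<^sup>+t. (\<integral>\<^sup>+x. indicator ?A x * (ennreal (t powr (real DIM('a) - 1)) * G (t *\<^sub>R x) * indicator {0<..} t) \<partial>lborel) \<partial>lborel)"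
    by (rule lborel_pair.Fubini'[symmetric]) measurable
  \<comment> \<open>The substitution \<open>y = t *\<^sub>R x\<close> produces the factor
    \<open>t\<close> to the power minus the dimension, which leaves \<open>1 / t\<close> of the
    radial weight.\<close>
  also have "\<dots> = (\<integral>\<^sup>+t. (\<integral>\<^sup>+y. ennreal (1 / t) * indicator {0<..} t * (indicator ?A ((1 / t) *\<^sub>R y) * G y) \<partial>lborel) \<partial>lborel)"
  proof (rule nn_integral_cong)
    fix t :: real
    show "(\<integral>\<^sup>+x. indicator ?A x * (ennreal (t powr (real DIM('a) - 1)) * G (t *\<^sub>R x) * indicator {0<..} t) \<partial>lborel)
      = (\<integral>\<^sup>+y. ennreal (1 / t) * indicator {0<..} t * (indicator ?A ((1 / t) *\<^sub>R y) * G y) \<partial>lborel)"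
    proof (cases "0 < t")
      case True
      have "(\<integral>\<^sup>+y. ennreal (1 / t) * indicator {0<..} t * (indicator ?A ((1 / t) *\<^sub>R y) * G y) \<partial>lborel)
        = ennreal (1 / t) * (\<integral>\<^sup>+y. indicator ?A ((1 / t) *\<^sub>R y) * G y \<partial>lborel)"
        using True by (simp add: nn_integral_cmult)
      also have "\<dots> = ennreal (1 / t) * (ennreal (t ^ DIM('a)) * (\<integral>\<^sup>+x. indicator ?A x * G (t *\<^sub>R x) \<partial>lborel))"
        using True by (subst nn_integral_lborel_scaleR[where c=t and a=0]) auto
      also have "\<dots> = ennreal (t powr (real DIM('a) - 1)) * (\<integral>\<^sup>+x. indicator ?A x * G (t *\<^sub>R x) \<partial>lborel)"
        using True by (simp add: powr_diff powr_realpow flip: ennreal_mult mult.assoc)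
      also have "\<dots> = (\<integral>\<^sup>+x. ennreal (t powr (real DIM('a) - 1)) * (indicator ?A x * G (t *\<^sub>R x)) \<partial>lborel)"
        by (rule nn_integral_cmult[symmetric]) measurable
      finally show ?thesis using True by (simp add: mult_ac)
    qed simp
  qed
  also have "\<dots> = (\<integral>\<^sup>+y. (\<integral>\<^sup>+t. ennreal (1 / t) * indicator {0<..} t * (indicator ?A ((1 / t) *\<^sub>R y) * G y) \<partial>lborel) \<partial>lborel)"
    by (rule lborel_pair.Fubini') measurable
  also have "\<dots> = (\<integral>\<^sup>+y. G y \<partial>lborel)"
  proof (rule nn_integral_cong_AE)
    have "AE y in lborel. y \<noteq> (0::'a)" by (rule AE_lborel_singleton)
    then show "AE y in lborel. (\<integral>\<^sup>+t. ennreal (1 / t) * indicator {0<..} t * (indicator ?A ((1 / t) *\<^sub>R y) * G y) \<partial>lborel) = G y"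
    proof eventually_elim
      case (elim y)
      have "(\<integral>\<^sup>+t. ennreal (1 / t) * indicator {0<..} t * (indicator ?A ((1 / t) *\<^sub>R y) * G y) \<partial>lborel)
        = (\<integral>\<^sup>+t. (ennreal (1 / t) * indicator {norm y / exp 1<..norm y} t) * G y \<partial>lborel)"
      proof (intro nn_integral_cong)
        fix t :: real
        have y: "0 < norm y / exp 1" using elim by simp
        \<comment> \<open>Closed inner and open outer boundary of the annulus become an open left
          and a closed right end in \<open>t\<close>; the ratio \<open>exp 1\<close> of the ends
          gives the interval logarithmic length 1.\<close>
        have "0 < t \<and> (1 / t) *\<^sub>R y \<in> ?A \<longleftrightarrow> t \<in> {norm y / exp 1<..norm y}"
        proof (cases "0 < t")
          case True
          then show ?thesis by (auto simp: field_simps)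
        next
          case False
          with y have "\<not> norm y / exp 1 < t" by linarith
          with False show ?thesis by simp
        qed
        then show "ennreal (1 / t) * indicator {0<..} t * (indicator ?A ((1 / t) *\<^sub>R y) * G y)
          = (ennreal (1 / t) * indicator {norm y / exp 1<..norm y} t) * G y"
          by (auto simp: indicator_def)
      qed
      also have "\<dots> = (\<integral>\<^sup>+t. ennreal (1 / t) * indicator {norm y / exp 1<..norm y} t \<partial>lborel) * G y"
        by (rule nn_integral_multc) measurable
      finally show ?case using elim by (simp add: nn_integral_inverse_Ioc)
    qed
  qed
  finally show ?thesis by simp
qed

section \<open>The autocorrelation and the volume of the radial set\<close>

text \<open>The functional covariogram, called g in the overview. Extended values allow Fubini and
  Prekopa--Leindler to be applied before any integrability is known.\<close>

definition autocorr :: "('a::euclidean_space \<Rightarrow> real) \<Rightarrow> 'a \<Rightarrow> ennreal" where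
  "autocorr f y = (\<integral>\<^sup>+x. ennreal (f x * f (x + y)) \<partial>lborel)"

lemma nn_integral_lborel_translate:
  fixes f :: "'a::euclidean_space \<Rightarrow> ennreal"
  assumes "f \<in> borel_measurable borel"
  shows "(\<integral>\<^sup>+x. f (x + a) \<partial>lborel) = (\<integral>\<^sup>+x. f x \<partial>lborel)"
  using nn_integral_lborel_scaleR[OF assms, of 1 a] by (simp add: add.commute)

lemma borel_measurable_autocorr [measurable]:
  fixes f :: "'a::euclidean_space \<Rightarrow> real"
  assumes [measurable]: "f \<in> borel_measurable borel"
  shows "autocorr f \<in> borel_measurable borel"
  unfolding autocorr_def by measurable

lemma autocorr_0: "autocorr f 0 = (\<integral>\<^sup>+x. ennreal ((f x)\<^sup>2) \<partial>lborel)"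
  by (simp add: autocorr_def power2_eq_square)

text \<open>By \<open>2 * u * v \<le> u^2 + v^2\<close> and translation invariance. It makes the
  autocorrelation finite everywhere as soon as the square integral is.\<close>

lemma autocorr_le:
  fixes f :: "'a::euclidean_space \<Rightarrow> real"
  assumes [measurable]: "f \<in> borel_measurable borel"
  shows "autocorr f y \<le> autocorr f 0"
proof -
  have "autocorr f y \<le> (\<integral>\<^sup>+x. ennreal (1/2) * ennreal ((f x)\<^sup>2) + ennreal (1/2) * ennreal ((f (x + y))\<^sup>2) \<partial>lborel)"
    unfolding autocorr_def
  proof (rule nn_integral_mono)
    fix x
    have "f x * f (x + y) \<le> 1/2 * (f x)\<^sup>2 + 1/2 * (f (x + y))\<^sup>2"
      using sum_squares_bound[of "f x" "f (x + y)"] by simp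
    then show "ennreal (f x * f (x + y)) \<le> ennreal (1/2) * ennreal ((f x)\<^sup>2) + ennreal (1/2) * ennreal ((f (x + y))\<^sup>2)"
      by (simp add: ennreal_leI flip: ennreal_mult ennreal_plus del: ennreal_half)
  qed
  also have "\<dots> = ennreal (1/2) * autocorr f 0 + ennreal (1/2) * (\<integral>\<^sup>+x. ennreal ((f (x + y))\<^sup>2) \<partial>lborel)"
    by (simp add: nn_integral_add nn_integral_cmult autocorr_0 del: ennreal_half)
  also have "(\<integral>\<^sup>+x. ennreal ((f (x + y))\<^sup>2) \<partial>lborel) = autocorr f 0"
    unfolding autocorr_0 by (rule nn_integral_lborel_translate) simp
  also have "ennreal (1/2) * autocorr f 0 + ennreal (1/2) * autocorr f 0 = autocorr f 0"
    by (simp flip: distrib_right ennreal_plus del: ennreal_half)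
  finally show ?thesis .
qed

lemma nn_integral_autocorr:
  fixes f :: "'a::euclidean_space \<Rightarrow> real"
  assumes [measurable]: "f \<in> borel_measurable borel" and nonneg: "\<And>x. 0 \<le> f x"
  shows "(\<integral>\<^sup>+y. autocorr f y \<partial>lborel) = (\<integral>\<^sup>+x. ennreal (f x) \<partial>lborel)\<^sup>2"
proof -
  have "(\<integral>\<^sup>+y. autocorr f y \<partial>lborel) = (\<integral>\<^sup>+x. (\<integral>\<^sup>+y. ennreal (f x * f (x + y)) \<partial>lborel) \<partial>lborel)"
    unfolding autocorr_def by (rule lborel_pair.Fubini') measurable
  also have "\<dots> = (\<integral>\<^sup>+x. ennreal (f x) * (\<integral>\<^sup>+y. ennreal (f y) \<partial>lborel) \<partial>lborel)"
  proof (rule nn_integral_cong)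
    fix x
    have "(\<integral>\<^sup>+y. ennreal (f x * f (x + y)) \<partial>lborel) = ennreal (f x) * (\<integral>\<^sup>+y. ennreal (f (y + x)) \<partial>lborel)"
      by (subst nn_integral_cmult[symmetric]) (auto simp: nonneg add.commute ennreal_mult)
    then show "(\<integral>\<^sup>+y. ennreal (f x * f (x + y)) \<partial>lborel) = ennreal (f x) * (\<integral>\<^sup>+y. ennreal (f y) \<partial>lborel)"
      by (simp add: nn_integral_lborel_translate[of "\<lambda>y. ennreal (f y)"])
  qed
  also have "\<dots> = (\<integral>\<^sup>+x. ennreal (f x) \<partial>lborel)\<^sup>2"
    by (simp add: nn_integral_multc power2_eq_square)
  finally show ?thesis .
qed

lemma log_concave_nonneg: "log_concave f \<Longrightarrow> 0 \<le> f x"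
  by (simp add: log_concave_def)

lemma log_concaveD:
  "log_concave f \<Longrightarrow> 0 \<le> t \<Longrightarrow> t \<le> 1 \<Longrightarrow> f x powr (1 - t) * f y powr t \<le> f ((1 - t) *\<^sub>R x + t *\<^sub>R y)"
  by (simp add: log_concave_def)

text \<open>Prekopa--Leindler in the integration variable. The factors are regrouped into the pairs
  \<open>f x\<close>, \<open>f u\<close> and \<open>f x\<close>, \<open>f (u + y)\<close>, whose
  convex combinations of arguments differ by exactly \<open>l *\<^sub>R y\<close>.\<close>

lemma autocorr_geo_le:
  fixes f :: "'a::euclidean_space \<Rightarrow> real"
  assumes [measurable]: "f \<in> borel_measurable borel" and lc: "log_concave f" and l: "0 < l" "l < 1"
  shows "geo_le l (autocorr f 0) (autocorr f y) (autocorr f (l *\<^sub>R y))"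
  unfolding autocorr_def
proof (rule Prekopa_Leindler[OF _ _ _ l])
  note [simp] = log_concave_nonneg[OF lc]
  fix x u :: 'a
  let ?z = "(1 - l) *\<^sub>R x + l *\<^sub>R u"
  have "(f x * f (x + 0)) powr (1 - l) * (f u * f (u + y)) powr l
     = (f x powr (1 - l) * f u powr l) * (f x powr (1 - l) * f (u + y) powr l)"
    by (simp add: powr_mult)
  also have "\<dots> \<le> f ?z * f ((1 - l) *\<^sub>R x + l *\<^sub>R (u + y))"
    using l by (intro mult_mono log_concaveD[OF lc]) auto
  finally show "geo_le l (ennreal (f x * f (x + 0))) (ennreal (f u * f (u + y))) (ennreal (f ?z * f (?z + l *\<^sub>R y)))"
    using l by (intro geo_le_ennrealI) (auto simp: algebra_simps)
qed measurable

lemma H_rad_pow_eq: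
  "H_rad_pow s f x = (\<integral>\<^sup>+t. ennreal (t powr (s - 1)) * autocorr f (t *\<^sub>R x) * indicator {0<..} t \<partial>lborel)"
  by (simp add: H_rad_pow_def autocorr_def nn_integral_completion)

lemma borel_measurable_H_rad_pow [measurable]:
  fixes f :: "'a::euclidean_space \<Rightarrow> real"
  assumes [measurable]: "f \<in> borel_measurable borel"
  shows "H_rad_pow s f \<in> borel_measurable borel"
  unfolding H_rad_pow_eq[abs_def] by measurable

text \<open>Substituting \<open>c * t\<close> for \<open>t\<close> shows homogeneity of degree
  \<open>- s\<close>. This lets any nonzero vector of the annulus stand for its direction.\<close>

lemma H_rad_pow_scaleR:
  fixes f :: "'a::euclidean_space \<Rightarrow> real"
  assumes [measurable]: "f \<in> borel_measurable borel" and "0 < c"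
  shows "H_rad_pow s f x = ennreal (c powr s) * H_rad_pow s f (c *\<^sub>R x)"
proof -
  have "H_rad_pow s f x = ennreal c * (\<integral>\<^sup>+t. ennreal ((c * t) powr (s - 1)) * autocorr f ((c * t) *\<^sub>R x) * indicator {0<..} (c * t) \<partial>lborel)"
    unfolding H_rad_pow_eq using assms by (subst nn_integral_real_affine[where c=c and t=0]) auto
  also have "\<dots> = ennreal c * (\<integral>\<^sup>+t. ennreal (c powr (s - 1)) * (ennreal (t powr (s - 1)) * autocorr f (t *\<^sub>R (c *\<^sub>R x)) * indicator {0<..} t) \<partial>lborel)"
  proof (rule arg_cong[where f="\<lambda>I. ennreal c * I"], rule nn_integral_cong)
    fix t :: real
    show "ennreal ((c * t) powr (s - 1)) * autocorr f ((c * t) *\<^sub>R x) * indicator {0<..} (c * t)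
      = ennreal (c powr (s - 1)) * (ennreal (t powr (s - 1)) * autocorr f (t *\<^sub>R (c *\<^sub>R x)) * indicator {0<..} t)"
      using assms by (cases "0 < t") (simp_all add: zero_less_mult_iff powr_mult ennreal_mult mult_ac)
  qed
  also have "\<dots> = ennreal c * (ennreal (c powr (s - 1)) * H_rad_pow s f (c *\<^sub>R x))"
    unfolding H_rad_pow_eq by (subst nn_integral_cmult) auto
  also have "\<dots> = ennreal (c powr s) * H_rad_pow s f (c *\<^sub>R x)"
    using assms by (simp add: powr_diff flip: mult.assoc ennreal_mult)
  finally show ?thesis .
qed

text \<open>Homogeneity cancels \<open>norm x powr \<alpha>\<close> on both sides, so the set can be
  read off along a ray without normalising \<open>x\<close>.\<close>

lemma H_set_ray_iff:
  fixes f :: "'a::euclidean_space \<Rightarrow> real"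
  assumes "f \<in> borel_measurable borel" "x \<noteq> 0" "0 < t"
  shows "t *\<^sub>R x \<in> H_set \<alpha> f \<longleftrightarrow> ennreal (t powr \<alpha>) \<le> H_rad_pow \<alpha> f x"
proof -
  have sgn: "sgn (t *\<^sub>R x) = (1 / norm x) *\<^sub>R x"
    using assms by (simp add: sgn_div_norm field_simps)
  have "H_rad_pow \<alpha> f ((1 / norm x) *\<^sub>R x) = ennreal (norm x powr \<alpha>) * H_rad_pow \<alpha> f x"
    using H_rad_pow_scaleR[OF assms(1), of "norm x" \<alpha> "(1 / norm x) *\<^sub>R x"] assms by simp
  moreover have "norm (t *\<^sub>R x) powr \<alpha> = norm x powr \<alpha> * t powr \<alpha>"
    using assms by (simp add: powr_mult)
  ultimately have "t *\<^sub>R x \<in> H_set \<alpha> f \<longleftrightarrow>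
      ennreal (norm x powr \<alpha>) * ennreal (t powr \<alpha>) \<le> ennreal (norm x powr \<alpha>) * H_rad_pow \<alpha> f x"
    unfolding H_set_def mem_Collect_eq sgn using assms by (simp add: ennreal_mult)
  also have "\<dots> \<longleftrightarrow> ennreal (t powr \<alpha>) \<le> H_rad_pow \<alpha> f x"
    using assms by (subst ennreal_mult_le_mult_iff) auto
  finally show ?thesis .
qed

lemma sets_borel_H_set [measurable]:
  fixes f :: "'a::euclidean_space \<Rightarrow> real"
  assumes [measurable]: "f \<in> borel_measurable borel"
  shows "H_set \<alpha> f \<in> sets borel"
  unfolding H_set_def by measurable

text \<open>This replaces the spherical integral of the n-th power of the radial function divided by
  n: for \<open>x\<close> in the annulus the inner integral is that quantity in the scale of
  \<open>x\<close>. It stays an integral, so infinite values of \<open>H_rad_pow\<close> need no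
  separate case.\<close>

lemma emeasure_H_set:
  fixes f :: "'a::euclidean_space \<Rightarrow> real"
  assumes [measurable]: "f \<in> borel_measurable borel"
  shows "emeasure lborel (H_set \<alpha> f) = (\<integral>\<^sup>+x. indicator {x. 1 \<le> norm x \<and> norm x < exp 1} x *
    (\<integral>\<^sup>+t. ennreal (t powr (real DIM('a) - 1)) * indicator {t. 0 < t \<and> ennreal (t powr \<alpha>) \<le> H_rad_pow \<alpha> f x} t \<partial>lborel) \<partial>lborel)"
proof -
  have "emeasure lborel (H_set \<alpha> f) = (\<integral>\<^sup>+x. indicator (H_set \<alpha> f) x \<partial>lborel)" by simp
  also have "\<dots> = (\<integral>\<^sup>+x. indicator {x. 1 \<le> norm x \<and> norm x < exp 1} x *
     (\<integral>\<^sup>+t. ennreal (t powr (real DIM('a) - 1)) * indicator (H_set \<alpha> f) (t *\<^sub>R x) * indicator {0<..} t \<partial>lborel) \<partial>lborel)"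
    by (rule nn_integral_polar_annulus) simp
  also have "\<dots> = (\<integral>\<^sup>+x. indicator {x. 1 \<le> norm x \<and> norm x < exp 1} x *
    (\<integral>\<^sup>+t. ennreal (t powr (real DIM('a) - 1)) * indicator {t. 0 < t \<and> ennreal (t powr \<alpha>) \<le> H_rad_pow \<alpha> f x} t \<partial>lborel) \<partial>lborel)"
  proof (rule nn_integral_cong)
    fix x :: 'a
    show "indicator {x. 1 \<le> norm x \<and> norm x < exp 1} x *
     (\<integral>\<^sup>+t. ennreal (t powr (real DIM('a) - 1)) * indicator (H_set \<alpha> f) (t *\<^sub>R x) * indicator {0<..} t \<partial>lborel)
     = indicator {x. 1 \<le> norm x \<and> norm x < exp 1} x *
    (\<integral>\<^sup>+t. ennreal (t powr (real DIM('a) - 1)) * indicator {t. 0 < t \<and> ennreal (t powr \<alpha>) \<le> H_rad_pow \<alpha> f x} t \<partial>lborel)"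
    proof (cases "x \<in> {x. 1 \<le> norm x \<and> norm x < exp 1}")
      case True
      then have "x \<noteq> 0" by auto
      then have "ennreal (t powr (real DIM('a) - 1)) * indicator (H_set \<alpha> f) (t *\<^sub>R x) * indicator {0<..} t
        = ennreal (t powr (real DIM('a) - 1)) * indicator {t. 0 < t \<and> ennreal (t powr \<alpha>) \<le> H_rad_pow \<alpha> f x} t" for t
        by (cases "0 < t") (simp_all add: indicator_def H_set_ray_iff[OF assms])
      then show ?thesis by simp
    qed simp
  qed
  finally show ?thesis .
qed

lemma nn_integral_powr_sublevel:
  fixes \<nu> n \<alpha> :: real
  assumes "0 \<le> \<nu>" "0 < n" "0 < \<alpha>"
  shows "(\<integral>\<^sup>+t. ennreal (t powr (n - 1)) * indicator {t. 0 < t \<and> ennreal (t powr \<alpha>) \<le> ennreal \<nu>} t \<partial>lborel)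
    = ennreal (\<nu> powr (n / \<alpha>) / n)"
proof -
  have "{t. 0 < t \<and> ennreal (t powr \<alpha>) \<le> ennreal \<nu>} = {0<..\<nu> powr (1 / \<alpha>)}"
  proof -
    have "ennreal (t powr \<alpha>) \<le> ennreal \<nu> \<longleftrightarrow> t \<le> \<nu> powr (1 / \<alpha>)" if "0 < t" for t
    proof -
      have "t powr \<alpha> \<le> \<nu> \<longleftrightarrow> (t powr \<alpha>) powr (1 / \<alpha>) \<le> \<nu> powr (1 / \<alpha>)"
        using assms that powr_mono2[of "1 / \<alpha>" "t powr \<alpha>" \<nu>] powr_less_mono2[of "1 / \<alpha>" \<nu> "t powr \<alpha>"]
        by force
      then show ?thesis using assms that by (simp add: powr_powr)
    qed
    then show ?thesis by auto
  qed
  then show ?thesis using assms by (simp add: nn_integral_powr_Ioc powr_powr)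
qed

text \<open>The radial weight of polar integration is the weight in \<open>H_rad_pow\<close> when
  its exponent is the dimension. This identifies the total of the moments of order n.\<close>

lemma nn_integral_autocorr_polar:
  fixes f :: "'a::euclidean_space \<Rightarrow> real"
  assumes [measurable]: "f \<in> borel_measurable borel"
  shows "(\<integral>\<^sup>+y. autocorr f y \<partial>lborel) =
    (\<integral>\<^sup>+x. indicator {x. 1 \<le> norm x \<and> norm x < exp 1} x * H_rad_pow (real DIM('a)) f x \<partial>lborel)"
  unfolding H_rad_pow_eq by (rule nn_integral_polar_annulus) simp

lemma H_rad_pow_le:
  fixes f :: "'a::euclidean_space \<Rightarrow> real"
  assumes [measurable]: "f \<in> borel_measurable borel" and lc: "log_concave f"
    and G: "autocorr f 0 = ennreal G" "0 < G"
    and ab: "0 < \<beta>" "\<beta> < \<alpha>" and m: "H_rad_pow \<beta> f x = ennreal m" "0 \<le> m"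
  shows "H_rad_pow \<alpha> f x \<le> ennreal (Gamma \<alpha> * G * (m / (Gamma \<beta> * G)) powr (\<alpha> / \<beta>))"
proof -
  define \<phi> where "\<phi> t = enn2real (autocorr f (t *\<^sub>R x))" for t
  have fin: "autocorr f y < \<infinity>" for y using autocorr_le[of f y] G by (simp add: order_le_less_trans[OF _ ennreal_less_top])
  have \<phi>: "ennreal (\<phi> t) = autocorr f (t *\<^sub>R x)" for t using fin by (simp add: \<phi>_def)
  have [measurable]: "\<phi> \<in> borel_measurable borel" unfolding \<phi>_def by measurable
  have 0: "\<phi> 0 = G" using G by (simp add: \<phi>_def)
  have nn: "0 \<le> \<phi> t" for t by (simp add: \<phi>_def)
  have H: "H_rad_pow s f x = (\<integral>\<^sup>+t. ennreal (t powr (s - 1) * \<phi> t) * indicator {0<..} t \<partial>lborel)" for s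
    unfolding H_rad_pow_eq by (intro nn_integral_cong) (simp add: ennreal_mult nn \<phi>)
  have "(\<integral>\<^sup>+t. ennreal (t powr (\<alpha> - 1) * \<phi> t) * indicator {0<..} t \<partial>lborel)
    \<le> ennreal (Gamma \<alpha> * \<phi> 0 * (m / (Gamma \<beta> * \<phi> 0)) powr (\<alpha> / \<beta>))"
  proof (rule log_concave_moment_comparison)
    fix t l :: real assume "0 < t" "0 < l" "l < 1"
    then have "geo_le l (ennreal (\<phi> 0)) (ennreal (\<phi> t)) (ennreal (\<phi> (l * t)))"
      using autocorr_geo_le[OF assms(1) lc, of l "t *\<^sub>R x"] by (simp add: \<phi>)
    then show "\<phi> 0 powr (1 - l) * \<phi> t powr l \<le> \<phi> (l * t)"
      by (rule geo_le_ennrealD) (simp_all add: nn)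
  qed (use ab m nn H G 0 in auto)
  then show ?thesis by (simp add: H 0)
qed

text \<open>The outer power \<open>n / \<alpha>\<close> undoes the inner
  \<open>\<alpha> / n\<close>, so the result is linear in \<open>m\<close>; the divisor
  \<open>n\<close> turns \<open>Gamma n\<close> into \<open>Gamma (n + 1)\<close>. This is the
  origin of the constant \<open>k\<close> in the two volume lemmas.\<close>

lemma radial_constant_eq:
  fixes G m \<alpha> n :: real
  assumes "0 < G" "0 < n" "n < \<alpha>" "0 \<le> m"
  shows "(Gamma \<alpha> * G * (m / (Gamma n * G)) powr (\<alpha> / n)) powr (n / \<alpha>) / n
    = (Gamma \<alpha> * G) powr (n / \<alpha>) / (Gamma (n + 1) * G) * m"
proof -
  have "Gamma (n + 1) = n * Gamma n" using assms Gamma_plus1[of n] nonpos_Ints_nonpos[of n] by force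
  moreover have "0 < Gamma n" "0 < Gamma \<alpha>" using assms by auto
  ultimately show ?thesis using assms
    by (simp add: powr_mult powr_powr)
qed

lemma emeasure_H_set_le:
  fixes f :: "'a::euclidean_space \<Rightarrow> real" and \<alpha> :: real
  defines "n \<equiv> real DIM('a)"
  assumes [measurable]: "f \<in> borel_measurable borel" and lc: "log_concave f" and \<alpha>: "n < \<alpha>"
    and G: "(\<integral>\<^sup>+x. ennreal ((f x)\<^sup>2) \<partial>lborel) = ennreal G" "0 < G"
    and L: "(\<integral>\<^sup>+x. ennreal (f x) \<partial>lborel) = ennreal L" "0 \<le> L"
  shows "emeasure lborel (H_set \<alpha> f) \<le> ennreal ((Gamma \<alpha> * G) powr (n / \<alpha>) / (Gamma (n + 1) * G) * L\<^sup>2)"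
proof -
  let ?A = "{x::'a. 1 \<le> norm x \<and> norm x < exp 1}"
  define k where "k = (Gamma \<alpha> * G) powr (n / \<alpha>) / (Gamma (n + 1) * G)"
  have n: "0 < n" by (simp add: n_def)
  have "0 \<le> k" using n G \<alpha> by (simp add: k_def)
  have I: "(\<integral>\<^sup>+x. indicator ?A x * H_rad_pow n f x \<partial>lborel) = ennreal (L\<^sup>2)"
    using nn_integral_autocorr_polar[of f] nn_integral_autocorr[of f] log_concave_nonneg[OF lc] L
    by (simp add: n_def power2_eq_square ennreal_mult)
  \<comment> \<open>The comparison needs a finite moment of order n on the ray; finiteness of the
    total \<open>L\<^sup>2\<close> gives it for almost every \<open>x\<close> of the
    annulus.\<close>
  then have "AE x in lborel. indicator ?A x * H_rad_pow n f x \<noteq> \<infinity>"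
    by (intro nn_integral_PInf_AE) auto
  then have ae: "AE x in lborel. indicator ?A x *
      (\<integral>\<^sup>+t. ennreal (t powr (n - 1)) * indicator {t. 0 < t \<and> ennreal (t powr \<alpha>) \<le> H_rad_pow \<alpha> f x} t \<partial>lborel)
     \<le> ennreal k * (indicator ?A x * H_rad_pow n f x)"
  proof eventually_elim
    case (elim x)
    show ?case
    proof (cases "x \<in> ?A")
      case True
      with elim obtain m where m: "H_rad_pow n f x = ennreal m" "0 \<le> m"
        by (cases "H_rad_pow n f x") auto
      define \<nu> where "\<nu> = Gamma \<alpha> * G * (m / (Gamma n * G)) powr (\<alpha> / n)"
      have "0 \<le> \<nu>" using n \<alpha> G by (simp add: \<nu>_def)
      have le: "H_rad_pow \<alpha> f x \<le> ennreal \<nu>"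
        unfolding \<nu>_def using G n \<alpha> m by (intro H_rad_pow_le lc) (auto simp: autocorr_0)
      have "(\<integral>\<^sup>+t. ennreal (t powr (n - 1)) * indicator {t. 0 < t \<and> ennreal (t powr \<alpha>) \<le> H_rad_pow \<alpha> f x} t \<partial>lborel)
        \<le> (\<integral>\<^sup>+t. ennreal (t powr (n - 1)) * indicator {t. 0 < t \<and> ennreal (t powr \<alpha>) \<le> ennreal \<nu>} t \<partial>lborel)"
        using le by (intro nn_integral_mono mult_left_mono indicator_leI) (auto intro: order_trans)
      also have "\<dots> = ennreal (\<nu> powr (n / \<alpha>) / n)"
        using \<open>0 \<le> \<nu>\<close> n \<alpha> by (intro nn_integral_powr_sublevel) auto
      also have "\<nu> powr (n / \<alpha>) / n = k * m"
        unfolding \<nu>_def k_def using G n \<alpha> m by (intro radial_constant_eq) auto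
      finally show ?thesis using True m \<open>0 \<le> k\<close> by (simp add: ennreal_mult)
    qed simp
  qed
  have "emeasure lborel (H_set \<alpha> f) \<le> (\<integral>\<^sup>+x. ennreal k * (indicator ?A x * H_rad_pow n f x) \<partial>lborel)"
    unfolding emeasure_H_set[OF assms(2)] using ae by (intro nn_integral_mono_AE) (simp add: n_def)
  also have "\<dots> = ennreal k * ennreal (L\<^sup>2)"
    by (subst nn_integral_cmult) (auto simp: I)
  finally show ?thesis using \<open>0 \<le> k\<close> by (simp add: k_def flip: ennreal_mult)
qed

text \<open>The autocorrelation is exponential along each ray with rate \<open>\<kappa>\<close>, so
  the comparison function is the autocorrelation itself and nothing is lost. In the application
  \<open>\<kappa>\<close> is the l1 norm of the coordinates in the basis \<open>V\<close>.\<close>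

lemma emeasure_H_set_eq:
  fixes f :: "'a::euclidean_space \<Rightarrow> real" and \<alpha> :: real and \<kappa> :: "'a \<Rightarrow> real"
  defines "n \<equiv> real DIM('a)"
  assumes [measurable]: "f \<in> borel_measurable borel" and nonneg: "\<And>x. 0 \<le> f x" and \<alpha>: "n < \<alpha>"
    and G: "0 < G" and ac: "\<And>y. autocorr f y = ennreal (G * exp (- \<kappa> y))"
    and \<kappa>: "\<And>t y. 0 < t \<Longrightarrow> \<kappa> (t *\<^sub>R y) = t * \<kappa> y" "\<And>y. y \<noteq> 0 \<Longrightarrow> 0 < \<kappa> y"
    and L: "(\<integral>\<^sup>+x. ennreal (f x) \<partial>lborel) = ennreal L" "0 \<le> L"
  shows "emeasure lborel (H_set \<alpha> f) = ennreal ((Gamma \<alpha> * G) powr (n / \<alpha>) / (Gamma (n + 1) * G) * L\<^sup>2)"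
proof -
  let ?A = "{x::'a. 1 \<le> norm x \<and> norm x < exp 1}"
  define k where "k = (Gamma \<alpha> * G) powr (n / \<alpha>) / (Gamma (n + 1) * G)"
  have n: "0 < n" by (simp add: n_def)
  have "0 \<le> k" using n G \<alpha> by (simp add: k_def)
  have I: "(\<integral>\<^sup>+x. indicator ?A x * H_rad_pow n f x \<partial>lborel) = ennreal (L\<^sup>2)"
    using nn_integral_autocorr_polar[of f] nn_integral_autocorr[of f] nonneg L
    by (simp add: n_def power2_eq_square ennreal_mult)
  have rad: "H_rad_pow s f x = ennreal (G * (Gamma s / \<kappa> x powr s))" if "x \<noteq> 0" "0 < s" for x s
  proof -
    have "H_rad_pow s f x = (\<integral>\<^sup>+t. ennreal G * (ennreal (t powr (s - 1) * exp (- (\<kappa> x * t))) * indicator {0<..} t) \<partial>lborel)"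
      unfolding H_rad_pow_eq
    proof (intro nn_integral_cong)
      fix t :: real
      show "ennreal (t powr (s - 1)) * autocorr f (t *\<^sub>R x) * indicator {0<..} t
        = ennreal G * (ennreal (t powr (s - 1) * exp (- (\<kappa> x * t))) * indicator {0<..} t)"
        using G by (cases "0 < t") (simp_all add: ac \<kappa> ennreal_mult mult_ac)
    qed
    also have "\<dots> = ennreal G * ennreal (Gamma s / \<kappa> x powr s)"
      using that \<kappa>(2)[OF that(1)] by (subst nn_integral_cmult) (auto simp: nn_integral_powr_exp)
    finally show ?thesis using that G by (simp only: ennreal_mult' less_imp_le)
  qed
  have pw: "indicator ?A x *
      (\<integral>\<^sup>+t. ennreal (t powr (n - 1)) * indicator {t. 0 < t \<and> ennreal (t powr \<alpha>) \<le> H_rad_pow \<alpha> f x} t \<partial>lborel)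
     = ennreal k * (indicator ?A x * H_rad_pow n f x)" for x
  proof (cases "x \<in> ?A")
    case True
    then have "x \<noteq> 0" by auto
    define m where "m = G * (Gamma n / \<kappa> x powr n)"
    have m: "H_rad_pow n f x = ennreal m" "0 \<le> m"
      using rad[OF \<open>x \<noteq> 0\<close> n] G n by (auto simp: m_def)
    define \<nu> where "\<nu> = Gamma \<alpha> * G * (m / (Gamma n * G)) powr (\<alpha> / n)"
    have "0 \<le> \<nu>" using n \<alpha> G by (simp add: \<nu>_def)
    \<comment> \<open>Recovering the rate from the moment of order n shows that the upper bound
      \<open>\<nu>\<close> of the general case is here the actual moment of order
      \<open>\<alpha>\<close>.\<close>
    have "m / (Gamma n * G) = \<kappa> x powr (- n)"
      using G less_imp_neq[OF Gamma_real_pos[OF n]] by (auto simp: m_def powr_minus_divide)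
    then have "\<nu> = G * (Gamma \<alpha> * \<kappa> x powr (- \<alpha>))"
      unfolding \<nu>_def using n by (simp only: powr_powr) simp
    then have "\<nu> = G * (Gamma \<alpha> / \<kappa> x powr \<alpha>)" by (simp add: powr_minus_divide)
    then have eq: "H_rad_pow \<alpha> f x = ennreal \<nu>"
      using rad[OF \<open>x \<noteq> 0\<close>, of \<alpha>] n \<alpha> by simp
    have "(\<integral>\<^sup>+t. ennreal (t powr (n - 1)) * indicator {t. 0 < t \<and> ennreal (t powr \<alpha>) \<le> H_rad_pow \<alpha> f x} t \<partial>lborel)
      = ennreal (\<nu> powr (n / \<alpha>) / n)"
      unfolding eq using \<open>0 \<le> \<nu>\<close> n \<alpha> by (intro nn_integral_powr_sublevel) auto
    also have "\<nu> powr (n / \<alpha>) / n = k * m"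
      unfolding \<nu>_def k_def using G n \<alpha> m by (intro radial_constant_eq) auto
    finally show ?thesis using True m \<open>0 \<le> k\<close> by (simp add: ennreal_mult)
  qed simp
  have "emeasure lborel (H_set \<alpha> f) = (\<integral>\<^sup>+x. ennreal k * (indicator ?A x * H_rad_pow n f x) \<partial>lborel)"
    unfolding emeasure_H_set[OF assms(2)] using pw by (simp add: n_def)
  also have "\<dots> = ennreal k * ennreal (L\<^sup>2)"
    by (subst nn_integral_cmult) (auto simp: I)
  finally show ?thesis using \<open>0 \<le> k\<close> by (simp add: k_def flip: ennreal_mult)
qed

section \<open>Borel representative, integrability and interpolation of norms\<close>

lemma convex_log_concave_support:
  assumes lc: "log_concave f"
  shows "convex {x. 0 < f x}"
proof (rule convexI)
  fix x y and u v :: real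
  assume A: "x \<in> {x. 0 < f x}" "y \<in> {x. 0 < f x}" "0 \<le> u" "0 \<le> v" "u + v = 1"
  then have u: "u = 1 - v" by simp
  have "0 < f x powr (1 - v) * f y powr v" using A by simp
  also have "\<dots> \<le> f ((1 - v) *\<^sub>R x + v *\<^sub>R y)" using A by (intro log_concaveD[OF lc]) auto
  finally show "u *\<^sub>R x + v *\<^sub>R y \<in> {x. 0 < f x}" by (simp add: u)
qed

text \<open>A log-concave function need not be Borel measurable on the boundary of its support, and that
  boundary is negligible.\<close>

lemma log_concave_borel_representative:
  fixes f :: "'a::euclidean_space \<Rightarrow> real"
  assumes lc: "log_concave f"
  obtains g where "g \<in> borel_measurable borel" "log_concave g" "AE x in lebesgue. f x = g x"
proof -
  define S where "S = interior {x. 0 < f x}"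
  define g where "g x = indicator S x *\<^sub>R f x" for x
  have S: "open S" "convex S" using convex_interior[OF convex_log_concave_support[OF lc]] by (auto simp: S_def)
  have pos: "0 < f x" if "x \<in> S" for x using that interior_subset by (auto simp: S_def)
  \<comment> \<open>A convex function on an open convex set in finite dimension is continuous, so
    \<open>f\<close> is continuous on the interior of its support.\<close>
  have "convex_on S (\<lambda>x. - ln (f x))"
  proof (rule convex_onI)
    fix t :: real and x y assume A: "0 < t" "t < 1" "x \<in> S" "y \<in> S"
    have "ln (f x powr (1 - t) * f y powr t) \<le> ln (f ((1 - t) *\<^sub>R x + t *\<^sub>R y))"
      using A pos[OF A(3)] pos[OF A(4)] by (intro ln_mono log_concaveD[OF lc]) auto
    then show "- ln (f ((1 - t) *\<^sub>R x + t *\<^sub>R y)) \<le> (1 - t) * - ln (f x) + t * - ln (f y)"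
      using pos[OF A(3)] pos[OF A(4)] by (simp add: ln_mult ln_powr)
  qed fact
  then have "continuous_on S (\<lambda>x. - ln (f x))" using S by (intro convex_on_continuous)
  then have "continuous_on S (\<lambda>x. exp (- (- ln (f x))))" by (rule continuous_on_compose2[where f="\<lambda>x. - ln (f x)" and t=UNIV and g="\<lambda>u. exp (- u)", rotated]) (auto intro!: continuous_intros)
  then have "continuous_on S f" by (rule continuous_on_eq) (simp add: pos)
  then have "g \<in> borel_measurable borel"
    unfolding g_def using S by (intro borel_measurable_continuous_on_indicator) auto
  moreover have "log_concave g"
    unfolding log_concave_def
  proof (intro conjI allI impI)
    show "0 \<le> g x" for x by (simp add: g_def log_concave_nonneg[OF lc])
    fix x y and t :: real assume t: "0 \<le> t \<and> t \<le> 1"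
    show "g x powr (1 - t) * g y powr t \<le> g ((1 - t) *\<^sub>R x + t *\<^sub>R y)"
    proof (cases "x \<in> S \<and> y \<in> S")
      case True
      then have "(1 - t) *\<^sub>R x + t *\<^sub>R y \<in> S" using S t by (auto intro: convexD)
      with True log_concaveD[OF lc, of t x y] t show ?thesis by (simp add: g_def)
    next
      case False
      \<comment> \<open>Relies on \<open>0 powr u = 0\<close> for every \<open>u\<close>, also for
        \<open>u = 0\<close>: at the endpoints \<open>t = 0\<close> and \<open>t = 1\<close> the
        left side vanishes even if the point of weight 1 lies in \<open>S\<close>.\<close>
      then have eq: "g x powr (1 - t) * g y powr t = 0" by (auto simp: g_def)
      show ?thesis unfolding eq by (simp add: g_def log_concave_nonneg[OF lc])
    qed
  qed
  moreover have "AE x in lebesgue. f x = g x"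
    unfolding eventually_ae_filter_negligible
  proof (intro exI conjI)
    show "negligible (frontier {x. 0 < f x})"
      by (rule negligible_convex_frontier[OF convex_log_concave_support[OF lc]])
    show "{x. f x \<noteq> g x} \<subseteq> frontier {x. 0 < f x}"
    proof
      fix x assume "x \<in> {x. f x \<noteq> g x}"
      then have "f x \<noteq> 0" "x \<notin> S" by (auto simp: g_def indicator_def split: if_splits)
      then have "x \<in> {x. 0 < f x}" "x \<notin> S" using log_concave_nonneg[OF lc, of x] by auto
      then show "x \<in> frontier {x. 0 < f x}"
        using closure_subset[of "{x. 0 < f x}"] by (auto simp: frontier_def S_def)
    qed
  qed
  ultimately show ?thesis by (rule that)
qed

text \<open>For each fixed shift the product of \<open>f\<close> and its translate changes only on a
  union of two null sets, so equality holds in every direction and not merely in almost every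
  one.\<close>

lemma H_rad_pow_cong_AE:
  fixes f g :: "'a::euclidean_space \<Rightarrow> real"
  assumes "AE x in lebesgue. f x = g x"
  shows "H_rad_pow s f = H_rad_pow s g"
proof -
  have "(\<integral>\<^sup>+x. ennreal (f x * f (x + y)) \<partial>lebesgue) = (\<integral>\<^sup>+x. ennreal (g x * g (x + y)) \<partial>lebesgue)" for y
  proof (rule nn_integral_cong_AE)
    obtain N where N: "negligible N" "{x. f x \<noteq> g x} \<subseteq> N"
      using assms by (auto simp: eventually_ae_filter_negligible)
    have "AE x in lebesgue. f (x + y) = g (x + y)"
      unfolding eventually_ae_filter_negligible
    proof (intro exI conjI)
      show "negligible ((+) (- y) ` N)" using N by (intro negligible_translation)
      show "{x. f (x + y) \<noteq> g (x + y)} \<subseteq> (+) (- y) ` N"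
        using N by (force simp: image_iff)
    qed
    with assms show "AE x in lebesgue. ennreal (f x * f (x + y)) = ennreal (g x * g (x + y))"
      by eventually_elim simp
  qed
  then show ?thesis by (simp add: H_rad_pow_def fun_eq_iff)
qed

text \<open>Comparing with a point where the function is positive bounds the t-th power of the function
  by a multiple of a dilate, so integrability passes to smaller exponents.\<close>

lemma log_concave_powr_integrable_mono:
  fixes f :: "'a::euclidean_space \<Rightarrow> real"
  assumes [measurable]: "f \<in> borel_measurable borel" and lc: "log_concave f" and x0: "0 < f x0"
    and qp: "0 < p" "p \<le> q" and fin: "(\<integral>\<^sup>+x. ennreal (f x powr q) \<partial>lborel) < \<infinity>"
  shows "(\<integral>\<^sup>+x. ennreal (f x powr p) \<partial>lborel) < \<infinity>"
proof -
  \<comment> \<open>Chosen so that the q-th power of \<open>f y powr t\<close> is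
    \<open>f y powr p\<close>.\<close>
  define t where "t = p / q"
  have t: "0 < t" "t \<le> 1" using qp by (auto simp: t_def)
  define c where "c = 1 / (f x0 powr (1 - t)) powr q"
  have "0 \<le> c" by (simp add: c_def)
  have pw: "f y powr p \<le> c * f ((1 - t) *\<^sub>R x0 + t *\<^sub>R y) powr q" for y
  proof -
    have "(f x0 powr (1 - t) * f y powr t) powr q \<le> f ((1 - t) *\<^sub>R x0 + t *\<^sub>R y) powr q"
      using qp t by (intro powr_mono2 log_concaveD[OF lc]) auto
    moreover have "(f y powr t) powr q = f y powr p" using qp by (simp add: powr_powr t_def)
    ultimately show ?thesis using x0 by (simp add: c_def powr_mult field_simps)
  qed
  have "(\<integral>\<^sup>+y. ennreal (f y powr p) \<partial>lborel)
      \<le> (\<integral>\<^sup>+y. ennreal c * ennreal (f ((1 - t) *\<^sub>R x0 + t *\<^sub>R y) powr q) \<partial>lborel)"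
    using pw \<open>0 \<le> c\<close> by (intro nn_integral_mono) (simp add: ennreal_leI flip: ennreal_mult)
  also have "\<dots> = ennreal c * (\<integral>\<^sup>+y. ennreal (f ((1 - t) *\<^sub>R x0 + t *\<^sub>R y) powr q) \<partial>lborel)"
    by (rule nn_integral_cmult) measurable
  also have "\<dots> < \<infinity>"
  proof -
    have "ennreal (t ^ DIM('a)) * (\<integral>\<^sup>+y. ennreal (f ((1 - t) *\<^sub>R x0 + t *\<^sub>R y) powr q) \<partial>lborel) < \<infinity>"
      using nn_integral_lborel_scaleR[of "\<lambda>y. ennreal (f y powr q)" t "(1 - t) *\<^sub>R x0"] fin t by simp
    then have "(\<integral>\<^sup>+y. ennreal (f ((1 - t) *\<^sub>R x0 + t *\<^sub>R y) powr q) \<partial>lborel) < \<infinity>"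
      using t by (auto simp: ennreal_mult_less_top less_top)
    then show ?thesis by (simp add: ennreal_mult_less_top)
  qed
  finally show ?thesis .
qed

text \<open>Hoelder interpolation through a pointwise weighted mean inequality for the normalised
  densities \<open>f powr p / P\<close> and \<open>f^2 / G\<close>. The weight
  \<open>u = 1 / (2 - p)\<close> solves \<open>p * u + 2 * (1 - u) = 1\<close>, so their geometric
  mean is \<open>f / K\<close>.\<close>

lemma nn_integral_interpolation:
  fixes f :: "'a::euclidean_space \<Rightarrow> real" and p :: real
  assumes [measurable]: "f \<in> borel_measurable borel" and nonneg: "\<And>x. 0 \<le> f x" and p: "0 < p" "p < 1"
    and P: "(\<integral>\<^sup>+x. ennreal (f x powr p) \<partial>lborel) = ennreal P" "0 < P"
    and G: "(\<integral>\<^sup>+x. ennreal ((f x)\<^sup>2) \<partial>lborel) = ennreal G" "0 < G"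
    and L: "(\<integral>\<^sup>+x. ennreal (f x) \<partial>lborel) = ennreal L" "0 \<le> L"
  shows "L \<le> P powr (1 / (2 - p)) * G powr (1 - 1 / (2 - p))"
proof -
  define u where "u = 1 / (2 - p)"
  have u: "0 < u" "u < 1" using p by (auto simp: u_def)
  define K where "K = P powr u * G powr (1 - u)"
  have "0 < K" using P G by (simp add: K_def)
  have pw: "f x \<le> K * u / P * f x powr p + K * (1 - u) / G * (f x)\<^sup>2" for x
  proof (cases "f x = 0")
    case False
    then have pos: "0 < f x" using nonneg[of x] by simp
    have "((f x)\<^sup>2 / G) powr (1 - u) * (f x powr p / P) powr (1 - (1 - u)) \<le> (1 - u) * ((f x)\<^sup>2 / G) + (1 - (1 - u)) * (f x powr p / P)"
      using powr_geo_mean_le_arith_mean[of "(f x)\<^sup>2 / G" "f x powr p / P" u] pos P G u by simp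
    moreover have "((f x)\<^sup>2 / G) powr (1 - u) * (f x powr p / P) powr (1 - (1 - u)) = f x / K"
    proof -
      have "((f x)\<^sup>2) powr (1 - u) * (f x powr p) powr u = f x powr (2 * (1 - u) + p * u)"
        using pos by (simp add: powr_powr powr_add flip: powr_numeral)
      also have "2 * (1 - u) + p * u = 2 - u * (2 - p)" by (simp add: algebra_simps)
      also have "\<dots> = 1" using p by (simp add: u_def)
      finally have "((f x)\<^sup>2) powr (1 - u) * (f x powr p) powr u = f x" using pos by simp
      then show ?thesis using pos P G by (simp add: powr_divide K_def mult_ac)
    qed
    ultimately have "f x / K \<le> (1 - u) * ((f x)\<^sup>2 / G) + u * (f x powr p / P)" by simp
    then have "f x \<le> K * ((1 - u) * ((f x)\<^sup>2 / G) + u * (f x powr p / P))"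
      using \<open>0 < K\<close> by (simp add: pos_divide_le_eq mult.commute)
    then show ?thesis by (simp add: algebra_simps)
  qed simp
  have "ennreal L \<le> (\<integral>\<^sup>+x. ennreal (K * u / P) * ennreal (f x powr p) + ennreal (K * (1 - u) / G) * ennreal ((f x)\<^sup>2) \<partial>lborel)"
    unfolding L(1)[symmetric] using pw \<open>0 < K\<close> u P G
    by (intro nn_integral_mono) (simp add: ennreal_leI flip: ennreal_mult ennreal_plus)
  also have "\<dots> = ennreal (K * u / P) * ennreal P + ennreal (K * (1 - u) / G) * ennreal G"
    by (simp add: nn_integral_add nn_integral_cmult P G)
  also have "\<dots> = ennreal (K * u / P * P + K * (1 - u) / G * G)"
    using \<open>0 < K\<close> u P G by (simp flip: ennreal_mult ennreal_plus)
  also have "K * u / P * P + K * (1 - u) / G * G = K * u + K * (1 - u)"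
    using P G by simp
  also have "\<dots> = K" by (simp add: algebra_simps)
  finally show ?thesis using \<open>0 < K\<close> by (simp add: K_def u_def)
qed

section \<open>Exponentials of a simplex gauge\<close>

text \<open>In the coordinates of the basis \<open>V\<close>, the dilate of the simplex by
  \<open>l\<close> is the part of the positive orthant with coordinate sum at most
  \<open>l\<close>.\<close>

lemma gauge_fn_simplex:
  fixes V :: "'a::euclidean_space set"
  assumes V: "independent V" "card V = DIM('a)"
  shows "gauge_fn (convex hull (insert 0 V)) x =
    (if \<forall>v\<in>V. 0 \<le> representation V x v then ereal (\<Sum>v\<in>V. representation V x v) else \<infinity>)"
proof -
  let ?c = "representation V"
  have fin: "finite V" using V independent_bound by blast
  have "UNIV \<subseteq> span V" using V by (intro card_ge_dim_independent) auto
  then have sp: "y \<in> span V" for y by auto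
  have hull: "convex hull (insert 0 V) = {y. \<exists>u. (\<forall>v\<in>V. 0 \<le> u v) \<and> sum u V \<le> 1 \<and> (\<Sum>v\<in>V. u v *\<^sub>R v) = y}"
    using V dependent_zero by (intro Starlike.simplex fin) blast
  have rep_sum: "?c (\<Sum>w\<in>V. u w *\<^sub>R w) v = u v" if "v \<in> V" for u v
  proof -
    have "?c (\<Sum>w\<in>V. u w *\<^sub>R w) v = (\<Sum>w\<in>V. ?c (u w *\<^sub>R w) v)"
      by (subst real_vector.representation_sum[OF V(1) sp]) simp
    also have "\<dots> = (\<Sum>w\<in>V. if w = v then u v else 0)"
      by (intro sum.cong refl) (auto simp: real_vector.representation_scale[OF V(1) sp] real_vector.representation_basis[OF V(1)])
    also have "\<dots> = u v" using fin that by simp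
    finally show ?thesis .
  qed
  have iff: "x \<in> (\<lambda>y. l *\<^sub>R y) ` (convex hull (insert 0 V)) \<longleftrightarrow> (\<forall>v\<in>V. 0 \<le> ?c x v) \<and> sum (?c x) V \<le> l"
    if l: "0 < l" for l
  proof
    assume "x \<in> (\<lambda>y. l *\<^sub>R y) ` (convex hull (insert 0 V))"
    then obtain u where u: "\<forall>v\<in>V. 0 \<le> u v" "sum u V \<le> 1" "x = l *\<^sub>R (\<Sum>v\<in>V. u v *\<^sub>R v)"
      by (auto simp: hull)
    have c: "?c x v = l * u v" if "v \<in> V" for v
      unfolding u(3) by (simp add: real_vector.representation_scale[OF V(1) sp] rep_sum[OF that])
    have "sum (?c x) V = l * sum u V" by (simp add: c sum_distrib_left)
    then show "(\<forall>v\<in>V. 0 \<le> ?c x v) \<and> sum (?c x) V \<le> l" using u l c by simp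
  next
    assume A: "(\<forall>v\<in>V. 0 \<le> ?c x v) \<and> sum (?c x) V \<le> l"
    have "x = l *\<^sub>R (\<Sum>v\<in>V. (?c x v / l) *\<^sub>R v)"
      using l real_vector.sum_representation_eq[OF V(1) sp fin order_refl, of x]
      by (simp add: scaleR_sum_right)
    moreover have "(\<Sum>v\<in>V. (?c x v / l) *\<^sub>R v) \<in> convex hull (insert 0 V)"
      unfolding hull using A l by (intro CollectI exI[of _ "\<lambda>v. ?c x v / l"]) (simp flip: sum_divide_distrib)
    ultimately show "x \<in> (\<lambda>y. l *\<^sub>R y) ` (convex hull (insert 0 V))" by blast
  qed
  show ?thesis
  proof (cases "\<forall>v\<in>V. 0 \<le> ?c x v")
    case True
    then have s: "0 \<le> sum (?c x) V" by (intro sum_nonneg) auto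
    have "Inf {ereal l |l. 0 < l \<and> sum (?c x) V \<le> l} = ereal (sum (?c x) V)"
    proof (rule antisym)
      \<comment> \<open>At the origin the coordinate sum is 0, which is not an admissible dilation
        factor; the infimum is then only approached, hence the argument with an arbitrary positive
        \<open>e\<close>.\<close>
      show "Inf {ereal l |l. 0 < l \<and> sum (?c x) V \<le> l} \<le> ereal (sum (?c x) V)"
      proof (rule ereal_le_epsilon2)
        fix e :: real assume "0 < e"
        then show "Inf {ereal l |l. 0 < l \<and> sum (?c x) V \<le> l} \<le> ereal (sum (?c x) V) + ereal e"
          using s by (intro Inf_lower) auto
      qed
    qed (auto intro: Inf_greatest)
    moreover have "gauge_fn (convex hull (insert 0 V)) x = Inf {ereal l |l. 0 < l \<and> sum (?c x) V \<le> l}"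
      unfolding gauge_fn_def using True iff by (intro arg_cong[where f=Inf]) auto
    ultimately show ?thesis using True by simp
  next
    case False
    \<comment> \<open>Outside the cone of the simplex no dilate contains the point; the infimum of
      the empty set is infinite, and \<open>exp_neg_ereal\<close> sends it to 0.\<close>
    then have empty: "{ereal l |l. 0 < l \<and> x \<in> (\<lambda>y. l *\<^sub>R y) ` (convex hull (insert 0 V))} = {}"
      using iff by auto
    show ?thesis unfolding gauge_fn_def empty using False by (auto simp: top_ereal_def)
  qed
qed

text \<open>In the coordinates given by the simplex, the intersection of the positive orthant with its
  translate by -y is again a translate of the orthant.\<close>

lemma autocorr_simplex_exponential:
  fixes V :: "'a::euclidean_space set" and f :: "'a \<Rightarrow> real"
  assumes V: "independent V" "card V = DIM('a)"
    and f: "f = (\<lambda>x. a * exp_neg_ereal (gauge_fn (convex hull (insert 0 V)) (x - x0)))"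
  shows "f \<in> borel_measurable borel"
    and "autocorr f y = ennreal (exp (- (\<Sum>v\<in>V. \<bar>representation V y v\<bar>))) * autocorr f 0"
    and "0 < t \<Longrightarrow> (\<Sum>v\<in>V. \<bar>representation V (t *\<^sub>R y) v\<bar>) = t * (\<Sum>v\<in>V. \<bar>representation V y v\<bar>)"
    and "y \<noteq> 0 \<Longrightarrow> 0 < (\<Sum>v\<in>V. \<bar>representation V y v\<bar>)"
proof -
  let ?c = "representation V"
  have fin: "finite V" using V independent_bound by blast
  have "UNIV \<subseteq> span V" using V by (intro card_ge_dim_independent) auto
  then have sp: "y \<in> span V" for y by auto
  have add: "?c (x + y) v = ?c x v + ?c y v" for x y v
    by (simp add: real_vector.representation_add[OF V(1) sp sp])
  have scale: "?c (r *\<^sub>R x) v = r * ?c x v" for r x v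
    by (simp add: real_vector.representation_scale[OF V(1) sp])
  have lin: "linear (\<lambda>x. ?c x v)" for v by (rule linearI) (simp_all add: add scale)
  have [measurable]: "(\<lambda>x. ?c x v) \<in> borel_measurable borel" for v
    by (intro borel_measurable_continuous_onI linear_continuous_on linear_conv_bounded_linear[THEN iffD1] lin)
  define h where "h x = (if \<forall>v\<in>V. 0 \<le> ?c x v then exp (- (\<Sum>v\<in>V. ?c x v)) else 0)" for x
  have fh: "f x = a * h (x - x0)" for x
    unfolding f gauge_fn_simplex[OF V] exp_neg_ereal_def h_def by simp
  have [measurable]: "h \<in> borel_measurable borel"
    unfolding h_def using fin by measurable
  have "(\<lambda>x. a * h (x - x0)) \<in> borel_measurable borel" by measurable
  then show mf[measurable]: "f \<in> borel_measurable borel" by (simp add: fh[abs_def])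
  show "(\<Sum>v\<in>V. \<bar>?c (t *\<^sub>R y) v\<bar>) = t * (\<Sum>v\<in>V. \<bar>?c y v\<bar>)" if "0 < t"
    using that by (simp add: scale abs_mult sum_distrib_left)
  show "0 < (\<Sum>v\<in>V. \<bar>?c y v\<bar>)" if "y \<noteq> 0"
  proof -
    have "\<exists>v\<in>V. ?c y v \<noteq> 0"
    proof (rule ccontr)
      assume "\<not> ?thesis"
      then have "(\<Sum>v\<in>V. ?c y v *\<^sub>R v) = 0" by simp
      with real_vector.sum_representation_eq[OF V(1) sp fin order_refl, of y] that show False by simp
    qed
    then show ?thesis using fin by (auto intro: sum_pos2)
  qed
  \<comment> \<open>The coordinatewise negative part of \<open>y\<close>: the least shift for which
    both \<open>m\<close> and \<open>m + y\<close> have nonnegative coordinates. It is the apex of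
    the intersection of the orthant with its translate by \<open>- y\<close>.\<close>
  define m where "m = (\<Sum>v\<in>V. max 0 (- ?c y v) *\<^sub>R v)"
  have cm: "?c m v = max 0 (- ?c y v)" if "v \<in> V" for v
  proof -
    have "?c m v = (\<Sum>w\<in>V. ?c (max 0 (- ?c y w) *\<^sub>R w) v)"
      unfolding m_def by (subst real_vector.representation_sum[OF V(1) sp]) simp
    also have "\<dots> = (\<Sum>w\<in>V. if w = v then max 0 (- ?c y v) else 0)"
      by (intro sum.cong refl) (auto simp: scale real_vector.representation_basis[OF V(1)])
    finally show ?thesis using fin that by simp
  qed
  have prod: "h (x + m) * h (x + m + y) = exp (- (\<Sum>v\<in>V. \<bar>?c y v\<bar>)) * (h x * h x)" for x
  proof (cases "\<forall>v\<in>V. 0 \<le> ?c x v")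
    case True
    have "\<forall>v\<in>V. 0 \<le> ?c (x + m) v" "\<forall>v\<in>V. 0 \<le> ?c (x + m + y) v"
      using True by (auto simp: add cm max_def)
    \<comment> \<open>Coordinatewise this is \<open>2 * max 0 (- r) + r = \<bar>r\<bar>\<close>, the
      source of the absolute values in the exponent.\<close>
    moreover have "(\<Sum>v\<in>V. ?c (x + m) v) + (\<Sum>v\<in>V. ?c (x + m + y) v)
      = (\<Sum>v\<in>V. \<bar>?c y v\<bar>) + ((\<Sum>v\<in>V. ?c x v) + (\<Sum>v\<in>V. ?c x v))"
      unfolding sum.distrib[symmetric] by (intro sum.cong refl) (auto simp: add cm max_def)
    ultimately show ?thesis using True by (simp add: h_def flip: exp_add)
  next
    case False
    then obtain v where v: "v \<in> V" "?c x v < 0" by (auto simp: not_le)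
    \<comment> \<open>In each coordinate either \<open>m\<close> or \<open>m + y\<close> is 0, so a
      negative coordinate of \<open>x\<close> persists in one of the two points.\<close>
    then have "?c (x + m) v < 0 \<or> ?c (x + m + y) v < 0"
      by (auto simp: add cm max_def)
    then have "h (x + m) = 0 \<or> h (x + m + y) = 0" using v(1) by (auto simp: h_def not_le)
    moreover have "h x = 0" using False by (auto simp: h_def)
    ultimately show ?thesis by auto
  qed
  have shift: "autocorr f z = (\<integral>\<^sup>+x. ennreal (f (x + w) * f (x + w + z)) \<partial>lborel)" for z w
    unfolding autocorr_def
    by (subst nn_integral_lborel_translate[of "\<lambda>x. ennreal (f x * f (x + z))"]) auto
  have "autocorr f y = (\<integral>\<^sup>+x. ennreal (f (x + (x0 + m)) * f (x + (x0 + m) + y)) \<partial>lborel)" by (rule shift)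
  also have "\<dots> = (\<integral>\<^sup>+x. ennreal (exp (- (\<Sum>v\<in>V. \<bar>?c y v\<bar>))) * ennreal (f (x + x0) * f (x + x0 + 0)) \<partial>lborel)"
  proof (rule nn_integral_cong)
    fix x
    have e: "x + (x0 + m) - x0 = x + m" "x + (x0 + m) + y - x0 = x + m + y" "x + x0 - x0 = x"
      by (auto simp: algebra_simps)
    have "f (x + (x0 + m)) * f (x + (x0 + m) + y) = a * a * (h (x + m) * h (x + m + y))"
      unfolding fh e by simp
    also have "\<dots> = exp (- (\<Sum>v\<in>V. \<bar>?c y v\<bar>)) * (f (x + x0) * f (x + x0 + 0))"
      unfolding prod fh e by (simp add: e)
    finally show "ennreal (f (x + (x0 + m)) * f (x + (x0 + m) + y))
      = ennreal (exp (- (\<Sum>v\<in>V. \<bar>?c y v\<bar>))) * ennreal (f (x + x0) * f (x + x0 + 0))"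
      by (simp add: ennreal_mult')
  qed
  also have "\<dots> = ennreal (exp (- (\<Sum>v\<in>V. \<bar>?c y v\<bar>))) * autocorr f 0"
    by (subst nn_integral_cmult) (auto simp: shift[of 0 x0])
  finally show "autocorr f y = ennreal (exp (- (\<Sum>v\<in>V. \<bar>?c y v\<bar>))) * autocorr f 0" .
qed

section \<open>Bookkeeping of exponents and the theorem\<close>

text \<open>The Gamma prefactor of the theorem is the one that cancels the Gamma values in the
  volume bound raised to \<open>\<alpha> / n\<close>. What remains is expressed in norms, with
  \<open>G\<close> the squared 2-norm and \<open>L\<close> the 1-norm.\<close>

lemma volume_constant_eq:
  fixes G L \<alpha> n :: real
  assumes "0 < G" "0 < n" "n < \<alpha>" "0 \<le> L"
  shows "Gamma (n + 1) powr (\<alpha> / n) / Gamma \<alpha> *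
      ((Gamma \<alpha> * G) powr (n / \<alpha>) / (Gamma (n + 1) * G) * L\<^sup>2) powr (\<alpha> / n)
    = (G powr (1/2)) powr (2 - 2 * \<alpha> / n) * L powr (2 * \<alpha> / n)"
proof -
  define E where "E = Gamma (n + 1)"
  define A where "A = Gamma \<alpha>"
  have g: "0 < E" "0 < A" using assms by (auto simp: E_def A_def)
  have "((A * G) powr (n / \<alpha>) / (E * G) * L\<^sup>2) powr (\<alpha> / n)
     = A * G / (E powr (\<alpha> / n) * G powr (\<alpha> / n)) * (L\<^sup>2) powr (\<alpha> / n)"
    using assms g by (simp add: powr_mult powr_divide powr_powr)
  moreover have "(L\<^sup>2) powr (\<alpha> / n) = L powr (2 * \<alpha> / n)"
  proof (cases "L = 0")
    case False
    then have "L\<^sup>2 = L powr 2" using assms by (simp add: powr_numeral)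
    then show ?thesis by (simp add: powr_powr)
  qed simp
  moreover have "(G powr (1/2)) powr (2 - 2 * \<alpha> / n) = G / G powr (\<alpha> / n)"
  proof -
    have "(G powr (1/2)) powr (2 - 2 * \<alpha> / n) = G powr (1 - \<alpha> / n)"
      by (simp add: powr_powr algebra_simps)
    then show ?thesis using assms by (simp add: powr_diff)
  qed
  ultimately have "E powr (\<alpha> / n) / A * ((A * G) powr (n / \<alpha>) / (E * G) * L\<^sup>2) powr (\<alpha> / n)
    = (G powr (1/2)) powr (2 - 2 * \<alpha> / n) * L powr (2 * \<alpha> / n)"
    using g assms by simp
  then show ?thesis by (simp add: E_def A_def)
qed

text \<open>For \<open>p = 2 * n / (n + \<alpha>)\<close> one has
  \<open>2 - p = 2 * \<alpha> / (n + \<alpha>)\<close>. Raising the interpolation bound to the power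
  \<open>2 * \<alpha> / n\<close> gives \<open>G\<close> the exponent
  \<open>\<alpha> / n - 1\<close>, which the 2-norm factor cancels, and gives \<open>P\<close> the
  exponent \<open>2 / p\<close>.\<close>

lemma norm_interpolation_exponents:
  fixes G L P \<alpha> n :: real
  assumes "0 < G" "0 < n" "n < \<alpha>" "0 \<le> L" "0 < P"
    and le: "L \<le> P powr (1 / (2 - 2 * n / (n + \<alpha>))) * G powr (1 - 1 / (2 - 2 * n / (n + \<alpha>)))"
  shows "(G powr (1/2)) powr (2 - 2 * \<alpha> / n) * L powr (2 * \<alpha> / n) \<le> (P powr (1 / (2 * n / (n + \<alpha>)))) ^ 2"
proof -
  define q where "q = 2 * \<alpha> / n"
  have "0 < q" using assms by (simp add: q_def)
  have "2 - 2 * n / (n + \<alpha>) = 2 * \<alpha> / (n + \<alpha>)" using assms by (simp add: field_simps)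
  then have u: "1 / (2 - 2 * n / (n + \<alpha>)) = (n + \<alpha>) / (2 * \<alpha>)" by simp
  have "L powr q \<le> (P powr ((n + \<alpha>) / (2 * \<alpha>)) * G powr (1 - (n + \<alpha>) / (2 * \<alpha>))) powr q"
    using le assms \<open>0 < q\<close> unfolding u by (intro powr_mono2) auto
  also have "\<dots> = P powr ((n + \<alpha>) / (2 * \<alpha>) * q) * G powr ((1 - (n + \<alpha>) / (2 * \<alpha>)) * q)"
    by (simp add: powr_mult powr_powr)
  also have "(n + \<alpha>) / (2 * \<alpha>) * q = (n + \<alpha>) / n" using assms by (simp add: q_def)
  also have "(1 - (n + \<alpha>) / (2 * \<alpha>)) * q = \<alpha> / n - 1" using assms by (simp add: q_def field_simps)
  finally have "L powr q \<le> P powr ((n + \<alpha>) / n) * G powr (\<alpha> / n - 1)" .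
  then have "G powr (1 - \<alpha> / n) * L powr q \<le> G powr (1 - \<alpha> / n) * (P powr ((n + \<alpha>) / n) * G powr (\<alpha> / n - 1))"
    by (intro mult_left_mono) auto
  also have "\<dots> = P powr ((n + \<alpha>) / n) * (G powr (1 - \<alpha> / n) * G powr (\<alpha> / n - 1))" by simp
  also have "G powr (1 - \<alpha> / n) * G powr (\<alpha> / n - 1) = 1" using assms by (simp flip: powr_add)
  also have "P powr ((n + \<alpha>) / n) * 1 = (P powr (1 / (2 * n / (n + \<alpha>)))) ^ 2"
  proof -
    have "(P powr (1 / (2 * n / (n + \<alpha>)))) ^ 2 = (P powr (1 / (2 * n / (n + \<alpha>)))) powr 2"
      using assms by (simp add: powr_numeral)
    also have "\<dots> = P powr ((n + \<alpha>) / n)"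
      unfolding powr_powr using assms by (intro arg_cong[where f="\<lambda>e. P powr e"]) (simp add: field_simps)
    finally show ?thesis by simp
  qed
  finally show ?thesis by (simp add: powr_powr q_def algebra_simps)
qed

theorem theorem15:
  fixes f :: "real ^ 'n \<Rightarrow> real" and \<alpha> :: real
  assumes alpha: "\<alpha> > real CARD('n)"
    and meas: "f \<in> borel_measurable lebesgue"
    and L2: "(\<integral>\<^sup>+ x. ennreal ((f x)\<^sup>2) \<partial>lebesgue) < \<infinity>"
    and lc: "log_concave f"
  shows "emeasure lebesgue (H_set \<alpha> f) < \<infinity>
    \<and> Gamma (real CARD('n) + 1) powr (\<alpha> / real CARD('n)) / Gamma \<alpha>
        * measure lebesgue (H_set \<alpha> f) powr (\<alpha> / real CARD('n))
      \<le> Lp_norm 2 f powr (2 - 2 * \<alpha> / real CARD('n)) * Lp_norm 1 f powr (2 * \<alpha> / real CARD('n))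
    \<and> Lp_norm 2 f powr (2 - 2 * \<alpha> / real CARD('n)) * Lp_norm 1 f powr (2 * \<alpha> / real CARD('n))
      \<le> Lp_norm (2 * real CARD('n) / (real CARD('n) + \<alpha>)) f ^ 2
    \<and> ((\<exists>a x\<^sub>0 V. a \<ge> 0 \<and> independent V \<and> card V = CARD('n) \<and>
          f = (\<lambda>x. a * exp_neg_ereal (gauge_fn (convex hull (insert 0 V)) (x - x\<^sub>0))))
        \<longrightarrow> Gamma (real CARD('n) + 1) powr (\<alpha> / real CARD('n)) / Gamma \<alpha>
              * measure lebesgue (H_set \<alpha> f) powr (\<alpha> / real CARD('n))
            = Lp_norm 2 f powr (2 - 2 * \<alpha> / real CARD('n)) * Lp_norm 1 f powr (2 * \<alpha> / real CARD('n)))"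
proof -
  define n where "n = real CARD('n)"
  have n: "0 < n" "n < \<alpha>" and DIM: "real DIM(real ^ 'n) = n" using alpha by (auto simp: n_def)
  obtain g where gm[measurable]: "g \<in> borel_measurable borel" and glc: "log_concave g"
    and ae: "AE x in lebesgue. f x = g x"
    using log_concave_borel_representative[OF lc] .
  \<comment> \<open>All norms are transferred to the Borel representative \<open>g\<close> at once,
    by letting \<open>F\<close> be arbitrary.\<close>
  have tr: "(\<integral>\<^sup>+x. F (f x) \<partial>lebesgue) = (\<integral>\<^sup>+x. F (g x) \<partial>lborel)" for F :: "real \<Rightarrow> ennreal"
  proof -
    have "(\<integral>\<^sup>+x. F (f x) \<partial>lebesgue) = (\<integral>\<^sup>+x. F (g x) \<partial>lebesgue)"
      by (rule nn_integral_cong_AE) (use ae in \<open>eventually_elim, simp\<close>)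
    then show ?thesis by (simp add: nn_integral_completion)
  qed
  have gnn: "0 \<le> g x" for x by (rule log_concave_nonneg[OF glc])
  have Lp: "Lp_norm p f = enn2real (\<integral>\<^sup>+x. ennreal (g x powr p) \<partial>lborel) powr (1 / p)" for p
    unfolding Lp_norm_def using tr[of "\<lambda>u. ennreal (\<bar>u\<bar> powr p)"] gnn by simp
  have Hfg: "H_set \<alpha> f = H_set \<alpha> g"
    unfolding H_set_def H_rad_pow_cong_AE[OF ae] ..
  have em: "emeasure lebesgue (H_set \<alpha> f) = emeasure lborel (H_set \<alpha> g)"
    unfolding Hfg using sets_borel_H_set[OF gm] by simp
  obtain G where G: "(\<integral>\<^sup>+x. ennreal ((g x)\<^sup>2) \<partial>lborel) = ennreal G" "0 \<le> G"
    using L2 tr[of "\<lambda>u. ennreal (u\<^sup>2)"] by (cases "\<integral>\<^sup>+x. ennreal ((g x)\<^sup>2) \<partial>lborel") auto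
  show ?thesis
  proof (cases "G = 0")
    case True
    then have g0: "AE x in lborel. ennreal ((g x)\<^sup>2) = 0"
      using G by (subst nn_integral_0_iff_AE[symmetric]) auto
    then have g0': "AE x in lebesgue. g x = 0"
      by (intro AE_completion) simp
    have "(\<integral>\<^sup>+x. ennreal (g x powr p) \<partial>lborel) = (\<integral>\<^sup>+x. 0 \<partial>(lborel :: (real ^ 'n) measure))" for p
      by (rule nn_integral_cong_AE) (use g0 in \<open>eventually_elim, simp\<close>)
    then have Lp0: "Lp_norm p f = 0" for p by (simp add: Lp)
    have "H_rad_pow \<alpha> g = H_rad_pow \<alpha> (\<lambda>_. 0)" by (rule H_rad_pow_cong_AE[OF g0'])
    then have "H_set \<alpha> g = {0}" by (auto simp: H_set_def H_rad_pow_def)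
    then have "emeasure lebesgue (H_set \<alpha> f) = 0" unfolding em by simp
    \<comment> \<open>Every term is 0, because \<open>0 powr r = 0\<close> for all real
      \<open>r\<close>; this includes the negative exponent \<open>2 - 2 * \<alpha> / n\<close> of
      the 2-norm.\<close>
    then show ?thesis by (simp add: Lp0 measure_def)
  next
    case False
    with G have "0 < G" by simp
    obtain x0 where x0: "0 < g x0"
    proof (rule ccontr)
      assume "\<not> thesis"
      then have "g x = 0" for x using that gnn[of x] by (metis order_le_less)
      then show False using G \<open>0 < G\<close> by simp
    qed
    have sq: "(g x)\<^sup>2 = g x powr 2" for x using gnn[of x] by simp
    have fin: "(\<integral>\<^sup>+x. ennreal (g x powr p) \<partial>lborel) < \<infinity>" if "0 < p" "p \<le> 2" for p
      using G that by (intro log_concave_powr_integrable_mono[OF gm glc x0, of p 2]) (auto simp: sq)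
    obtain L where L: "(\<integral>\<^sup>+x. ennreal (g x) \<partial>lborel) = ennreal L" "0 \<le> L"
      using fin[of 1] gnn by (cases "\<integral>\<^sup>+x. ennreal (g x) \<partial>lborel") auto
    define p where "p = 2 * n / (n + \<alpha>)"
    have p: "0 < p" "p < 1" using n by (auto simp: p_def)
    obtain P where P: "(\<integral>\<^sup>+x. ennreal (g x powr p) \<partial>lborel) = ennreal P" "0 \<le> P"
      using fin[of p] p by (cases "\<integral>\<^sup>+x. ennreal (g x powr p) \<partial>lborel") auto
    have "P \<noteq> 0"
    proof
      assume "P = 0"
      then have "AE x in lborel. ennreal (g x powr p) = 0"
        using P by (subst nn_integral_0_iff_AE[symmetric]) auto
      then have "(\<integral>\<^sup>+x. ennreal ((g x)\<^sup>2) \<partial>lborel) = (\<integral>\<^sup>+x. 0 \<partial>(lborel :: (real ^ 'n) measure))"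
        by (intro nn_integral_cong_AE) (elim eventually_mono, simp)
      with G \<open>0 < G\<close> show False by simp
    qed
    with P have "0 < P" by simp
    have N2: "Lp_norm 2 f = G powr (1/2)" using G gnn by (simp add: Lp flip: sq)
    have N1: "Lp_norm 1 f = L" using L gnn by (simp add: Lp)
    have Np: "Lp_norm p f = P powr (1/p)" using P by (simp add: Lp)
    \<comment> \<open>The volume bound obtained by integrating the directional bounds; it is
      attained for the simplex exponential, so the same \<open>K\<close> serves the inequality and
      the equality case.\<close>
    define K where "K = (Gamma \<alpha> * G) powr (n / \<alpha>) / (Gamma (n + 1) * G) * L\<^sup>2"
    have "0 \<le> K" using n \<open>0 < G\<close> by (simp add: K_def)
    have vol: "emeasure lebesgue (H_set \<alpha> f) \<le> ennreal K"
      unfolding em K_def using emeasure_H_set_le[OF gm glc, of \<alpha> G L] n DIM G L \<open>0 < G\<close> by simp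
    then have "measure lebesgue (H_set \<alpha> f) \<le> K"
      unfolding measure_def by (intro enn2real_leI \<open>0 \<le> K\<close>)
    then have "Gamma (n + 1) powr (\<alpha> / n) / Gamma \<alpha> * measure lebesgue (H_set \<alpha> f) powr (\<alpha> / n)
        \<le> Gamma (n + 1) powr (\<alpha> / n) / Gamma \<alpha> * K powr (\<alpha> / n)"
      using n by (intro mult_left_mono powr_mono2) auto
    also have K_eq: "\<dots> = Lp_norm 2 f powr (2 - 2 * \<alpha> / n) * Lp_norm 1 f powr (2 * \<alpha> / n)"
      unfolding K_def N1 N2 using \<open>0 < G\<close> n L by (intro volume_constant_eq) auto
    finally have first: "Gamma (n + 1) powr (\<alpha> / n) / Gamma \<alpha> * measure lebesgue (H_set \<alpha> f) powr (\<alpha> / n)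
        \<le> Lp_norm 2 f powr (2 - 2 * \<alpha> / n) * Lp_norm 1 f powr (2 * \<alpha> / n)" .
    have "L \<le> P powr (1 / (2 - p)) * G powr (1 - 1 / (2 - p))"
      by (rule nn_integral_interpolation[OF gm gnn p P(1) \<open>0 < P\<close> G(1) \<open>0 < G\<close> L])
    then have second: "Lp_norm 2 f powr (2 - 2 * \<alpha> / n) * Lp_norm 1 f powr (2 * \<alpha> / n) \<le> Lp_norm p f ^ 2"
      unfolding N1 N2 Np using \<open>0 < G\<close> n L \<open>0 < P\<close> unfolding p_def by (intro norm_interpolation_exponents) auto
    have third: "Gamma (n + 1) powr (\<alpha> / n) / Gamma \<alpha> * measure lebesgue (H_set \<alpha> f) powr (\<alpha> / n)
        = Lp_norm 2 f powr (2 - 2 * \<alpha> / n) * Lp_norm 1 f powr (2 * \<alpha> / n)"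
      if V: "independent V" "card V = CARD('n)"
        and f: "f = (\<lambda>x. a * exp_neg_ereal (gauge_fn (convex hull (insert 0 V)) (x - x\<^sub>0)))" for a x\<^sub>0 V
    proof -
      have V': "card V = DIM(real ^ 'n)" using V by simp
      note simplex = autocorr_simplex_exponential[OF V(1) V' f]
      \<comment> \<open>In the equality case \<open>f\<close> itself is Borel, so the
        autocorrelation formula is applied to \<open>f\<close> directly; \<open>tr\<close> shows
        that its integrals are still \<open>G\<close> and \<open>L\<close>.\<close>
      have "autocorr f 0 = ennreal G"
        using G tr[of "\<lambda>u. ennreal (u\<^sup>2)"] by (simp add: autocorr_0 nn_integral_completion)
      then have ac: "autocorr f y = ennreal (G * exp (- (\<Sum>v\<in>V. \<bar>representation V y v\<bar>)))" for y
        using simplex(2)[of y] \<open>0 < G\<close> by (simp add: ennreal_mult mult.commute)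
      have Lf: "(\<integral>\<^sup>+x. ennreal (f x) \<partial>lborel) = ennreal L"
        using L tr[of ennreal] by (simp add: nn_integral_completion)
      have "emeasure lborel (H_set \<alpha> f) = ennreal K"
        unfolding K_def
        using emeasure_H_set_eq[OF simplex(1) log_concave_nonneg[OF lc] _ \<open>0 < G\<close> ac simplex(3,4) Lf L(2), of \<alpha>] n DIM
        by simp
      then have "measure lebesgue (H_set \<alpha> f) = K"
        using \<open>0 \<le> K\<close> em Hfg by (simp add: measure_def)
      then show ?thesis using K_eq by simp
    qed
    show ?thesis
      using vol first second third unfolding n_def[symmetric] p_def[symmetric]
      by (auto intro: order_le_less_trans[OF _ ennreal_less_top])
  qed
qed

end
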